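(* For every $\lambda\in[0,1]$, all positive integers $m\le n$, and every $\Gamma\in(0,1]$, the competition complexity of the VCG auction in the $m$-unit, $n$-buyer market over the class $\mathcal F_{(\lambda\text{-Reg})}$ of $\lambda$-regular distributions coincides with that over the subclass $\mathcal F^*_{(\lambda)}\subsetneq\mathcal F_{(\lambda\text{-Reg})}$ of truncated $\lambda$-generalized Pareto distributions: $$\mathrm{CC}(m,n,\mathcal F_{(\lambda\text{-Reg})},\Gamma)=\mathrm{CC}(m,n,\mathcal F^*_{(\lambda)},\Gamma).$$
   Context: Distributions. A valuation distribution $F$ is a probability distribution on $[0,\infty)$; $F$ also denotes its CDF with the convention $F(v)=\Pr_{x\sim F}[x<v]$. Its support is an interval on which it has a density $f$, except that an atom at the right endpoint of the support is allowed (in particular point masses are allowed). It is assumed that some price $p\in\mathrm{supp}(F)$ maximizes $p\,(1-F(p))$ over $p\ge0$; such a maximizer is called a monopoly reserve $r^*$. For $\lambda\in[0,1]$, $F$ is $\lambda$-regular if $\lambda v-\frac{1-F(v)}{f(v)}$ is non-decreasing in $v$ on the support (excluding the possible atom at its right endpoint); $\lambda=1$ is regularity and $\lambda=0$ is the monotone hazard rate (MHR) condition. $\mathcal F_{(\lambda\text{-Reg})}$ is the class of $\lambda$-regular distributions. For $\lambda\in(0,1]$ and finite $r\in[1,(1-\lambda)^{-1/\lambda}]$ (for $\lambda=1$: $r\in[1,\infty)$), the $r$-truncated $\lambda$-generalized Pareto distribution $F_{(\lambda,r)}$ has CDF (same convention) $F_{(\lambda,r)}(v)=1-\left(\frac{r^\lambda-1}{r}v+1\right)^{-1/\lambda}$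 for $v\in[0,r]$ and $F_{(\lambda,r)}(v)=1$ for $v>r$; it has an atom of mass $1/r$ at $r$. For $\lambda=0$ and $r\in[1,e]$, $F_{(0,r)}(v)=1-r^{-v/r}$ for $v\in[0,r]$ and $1$ for $v>r$. $\mathcal F^*_{(\lambda)}$ is the set of all $F_{(\lambda,r)}$ with $r$ in the stated range. Mechanisms. In an $m$-unit, $N$-buyer market ($m\le N$) the buyers have unit demand and values drawn i.i.d. from $F$; all bid truthfully. The VCG auction gives one unit to each of the $m$ highest-valued buyers (ties broken arbitrarily) and each winner pays the $(m+1)$-th highest value (taken to be $0$ if $N=m$). $\mathrm{RevVCG}_{m:N}(F)$ is its expected total payment. The Bayesian-optimal mechanism with monopoly reserve $r^*$ gives one unit to each of the $m$ highest-valued buyers whose value is at least $r^*$; each winner pays the maximum of $r^*$ and the $(m+1)$-th highest value ($0$ if $N=m$). $\mathrm{RevOPT}_{m:N}(F)$ is its expected total payment. Competition complexity. $\mathrm{CC}(m,n,\mathcal F,\Gamma)=\min\{k\in\mathbb Z_{\ge0}:\ \forall F\in\mathcal F,\ \mathrm{RevVCG}_{m:n+k}(F)\ge\Gamma\cdot\mathrm{RevOPT}_{m:n}(F)\}$ (and $\infty$ if no such $k$ exists). *)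

theory Defs
  imports "HOL-Probability.Probability" "HOL-Library.Extended_Nat"
begin

text \<open>A distribution is a Borel probability measure on the real line.  Note the strict
  inequality in the distribution function, unlike the library's \<^const>\<open>cdf\<close>.\<close>

definition CDF :: "real measure \<Rightarrow> real \<Rightarrow> real" where
  "CDF F v = measure F {..<v}"

definition msupp :: "real measure \<Rightarrow> real set" where
  "msupp F = {x. \<forall>e>0. measure F {x - e<..<x + e} > 0}"

definition cont_supp :: "real measure \<Rightarrow> real set" where
  "cont_supp F = {v \<in> msupp F. measure F {v} = 0}"

definition has_density :: "real measure \<Rightarrow> (real \<Rightarrow> real) \<Rightarrow> bool" where
  "has_density F f \<longleftrightarrow>
     f \<in> borel_measurable borel \<and> (\<forall>v. 0 \<le> f v) \<and>
     (\<forall>A\<in>sets borel. A \<subseteq> cont_supp F \<longrightarrow>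
        emeasure F A = (\<integral>\<^sup>+v\<in>A. ennreal (f v) \<partial>lborel))"

definition monopoly_reserve :: "real measure \<Rightarrow> real \<Rightarrow> bool" where
  "monopoly_reserve F p \<longleftrightarrow>
     p \<in> msupp F \<and> (\<forall>q\<ge>0. q * (1 - CDF F q) \<le> p * (1 - CDF F p))"

definition valuation_distribution :: "real measure \<Rightarrow> bool" where
  "valuation_distribution F \<longleftrightarrow>
     prob_space F \<and> sets F = sets borel \<and> measure F {..<0} = 0 \<and>
     is_interval (msupp F) \<and>
     (\<forall>v. measure F {v} > 0 \<longrightarrow> (\<forall>w\<in>msupp F. w \<le> v)) \<and>
     (\<exists>f. has_density F f) \<and>
     (\<exists>p. monopoly_reserve F p)"

text \<open>The virtual value takes values in \<^typ>\<open>ereal\<close>, so that it is \<open>-\<infinity>\<close> where the density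
  vanishes and \<open>F < 1\<close> (for instance at the left endpoint of the support), rather than being
  governed by the real convention \<open>x / 0 = 0\<close>.  At a right endpoint without atom,
  \<open>1 - F = 0\<close> and the value is \<open>l * v\<close>.  As a density is unique only up to null sets,
  monotonicity is required of some version of it.\<close>

definition lambda_regular :: "real \<Rightarrow> real measure \<Rightarrow> bool" where
  "lambda_regular l F \<longleftrightarrow>
     (\<exists>f. has_density F f \<and>
        mono_on (cont_supp F)
          (\<lambda>v. ereal (l * v) - ereal (1 - CDF F v) / ereal (f v)))"

definition regular_class :: "real \<Rightarrow> real measure set" where
  "regular_class l = {F. valuation_distribution F \<and> lambda_regular l F}"

definition gpd_CDF :: "real \<Rightarrow> real \<Rightarrow> real \<Rightarrow> real" where
  "gpd_CDF l r v =
     (if v > r then 1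
      else if l = 0 then 1 - r powr (- v / r)
      else 1 - ((r powr l - 1) / r * v + 1) powr (- 1 / l))"

definition gpd_range :: "real \<Rightarrow> real set" where
  "gpd_range l =
     (if l = 0 then {1..exp 1}
      else if l = 1 then {1..}
      else {1..(1 - l) powr (- 1 / l)})"

text \<open>A Borel probability measure is determined by its distribution function.  As
  \<^term>\<open>gpd_CDF l r 0 = 0\<close>, prescribing it on \<open>[0,\<infinity>)\<close> is enough.\<close>

definition gpd_class :: "real \<Rightarrow> real measure set" where
  "gpd_class l =
     {F. prob_space F \<and> sets F = sets borel \<and>
         (\<exists>r\<in>gpd_range l. \<forall>v\<ge>0. CDF F v = gpd_CDF l r v)}"

text \<open>Buyers are \<open>0, \<dots>, N - 1\<close>, and \<open>x i\<close> is the value of buyer \<open>i\<close>.  Ties are broken in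
  favour of the smaller index; the total payments do not depend on this choice.\<close>

definition winners :: "nat \<Rightarrow> nat \<Rightarrow> (nat \<Rightarrow> real) \<Rightarrow> nat set" where
  "winners m N x =
     {i. i < N \<and> card {j. j < N \<and> (x j > x i \<or> x j = x i \<and> j < i)} < m}"

text \<open>The \<open>(m+1)\<close>-th highest value (list indices start at 0).\<close>

definition losing_value :: "nat \<Rightarrow> nat \<Rightarrow> (nat \<Rightarrow> real) \<Rightarrow> real" where
  "losing_value m N x = (if m < N then rev (sort (map x [0..<N])) ! m else 0)"

definition VCG_payment :: "nat \<Rightarrow> nat \<Rightarrow> (nat \<Rightarrow> real) \<Rightarrow> real" where
  "VCG_payment m N x = (\<Sum>i\<in>winners m N x. losing_value m N x)"

definition OPT_payment :: "nat \<Rightarrow> nat \<Rightarrow> real \<Rightarrow> (nat \<Rightarrow> real) \<Rightarrow> real" where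
  "OPT_payment m N p x =
     (\<Sum>i\<in>{i \<in> winners m N x. p \<le> x i}. max p (losing_value m N x))"

text \<open>For valuation distributions the payments are integrable even if the mean is infinite:
  the existence of a monopoly reserve gives \<open>1 - F v \<le> C / v\<close>, so the \<open>(m+1)\<close>-th highest
  value, for \<open>m \<ge> 1\<close>, has tail \<open>O(1 / v\<^sup>2)\<close>.\<close>

definition RevVCG :: "nat \<Rightarrow> nat \<Rightarrow> real measure \<Rightarrow> real" where
  "RevVCG m N F = (\<integral>x. VCG_payment m N x \<partial>(\<Pi>\<^sub>M i\<in>{..<N}. F))"

definition RevOPT :: "nat \<Rightarrow> nat \<Rightarrow> real measure \<Rightarrow> real \<Rightarrow> real" where
  "RevOPT m N F p = (\<integral>x. OPT_payment m N p x \<partial>(\<Pi>\<^sub>M i\<in>{..<N}. F))"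

text \<open>A distribution may have several monopoly reserves; the comparison is required for each
  of them.  For regular distributions \<^const>\<open>RevOPT\<close> does not depend on the choice.
  The infimum of the empty set in \<^typ>\<open>enat\<close> is \<open>\<infinity>\<close>.\<close>

definition CC :: "nat \<Rightarrow> nat \<Rightarrow> real measure set \<Rightarrow> real \<Rightarrow> enat" where
  "CC m n \<F> \<Gamma> =
     Inf (enat ` {k. \<forall>F\<in>\<F>. \<forall>p. monopoly_reserve F p \<longrightarrow>
            RevVCG m (n + k) F \<ge> \<Gamma> * RevOPT m n F p})"

end

theory Submission imports Defs begin

text \<open>Let \<open>p\<close> be a reserve of a \<open>l\<close>-regular \<open>F\<close>, sold at with probability \<open>1 / r\<close>.  The generalized
  Pareto tail with parameter \<open>r\<close>, rescaled by \<open>p / r\<close>, has constant virtual value and agrees with the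
  tail of \<open>F\<close> at \<open>0\<close> and at \<open>p\<close>.  The virtual value of \<open>F\<close> crosses this constant at most once, hence
  the tail of \<open>F\<close> dominates the Pareto tail on \<open>[0, p]\<close>, and optimality of \<open>p\<close> forces \<open>r\<close> into the
  admissible range.  Values below \<open>p\<close> thus contribute at least as much to VCG as in the Pareto
  case, while the number of sales at the reserve is the same.  The part of the payments
  above \<open>p\<close> is \<open>m\<close> times the excess of the losing value over \<open>p\<close> for both mechanisms and grows
  with the number of buyers, so it can only help VCG.\<close>

section \<open>Payments and order statistics\<close>

text \<open>A density is fixed only up to null sets, so the tail of \<open>F\<close> has no
  pointwise derivative to work with. Hazard rates are therefore compared through increments over
  short intervals, with an error quadratic in their length that disappears under refinement. The
  Pareto law is never sampled separately: it is the image of \<open>F\<close> under a map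
  \<open>T\<close>, so that both markets live on one product space and payments are compared
  pointwise. The parameter \<open>r\<close> normalizes: the Pareto tail sells at price
  \<open>r\<close> with probability \<open>1 / r\<close>, so its reserve revenue per buyer is 1, and
  \<open>p / r\<close> is the exchange rate between the two markets. The excess over the reserve
  enters with factor \<open>\<Gamma>\<close> on the optimal side and 1 on the VCG side, which is
  where \<open>\<Gamma> \<le> 1\<close> matters. Two boundary cases escape the hazard rate argument:
  \<open>r = 1\<close>, where the Pareto law is a point mass, and a reserve with zero revenue, where
  \<open>F\<close> sits at 0. Since the mean may be infinite, integrability of the payments has to
  be extracted from the optimality of the reserve.\<close>

lemma sorted_desc_nth_ge_iff:
  fixes v :: "'a::linorder"
  assumes "sorted_wrt (\<ge>) ys" "m < length ys"
  shows "v \<le> ys ! m \<longleftrightarrow> m < length (filter (\<lambda>y. v \<le> y) ys)"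
  using assms
proof (induction ys arbitrary: m)
  case (Cons y ys)
  show ?case
  proof (cases "v \<le> y")
    case True
    then show ?thesis using Cons by (cases m) auto
  next
    case False
    then have *: "\<not> v \<le> z" if "z \<in> set (y # ys)" for z
      using Cons.prems(1) that by (auto simp: not_le)
    have "filter (\<lambda>y. v \<le> y) (y # ys) = []"
      using * by (simp add: filter_empty_conv)
    moreover have "\<not> v \<le> (y # ys) ! m"
      using * nth_mem[OF Cons.prems(2)] .
    ultimately show ?thesis by (simp only: list.size not_less0)
  qed
qed simp

text \<open>Sorting preserves the multiset of values, so the count can be made over buyers.
  Monotonicity, scaling and measurability of the losing value are all derived from this equivalence
  instead of the sorted list.\<close>

lemma losing_value_ge_iff:
  assumes "m < N"
  shows "v \<le> losing_value m N x \<longleftrightarrow> m < card {i. i < N \<and> v \<le> x i}"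
proof -
  let ?xs = "map x [0..<N]"
  have "length (filter (\<lambda>y. v \<le> y) (rev (sort ?xs))) = length (filter (\<lambda>y. v \<le> y) ?xs)"
    by (simp only: flip: size_mset) (simp only: mset_filter mset_rev mset_sort)
  also have "\<dots> = card {i. i < N \<and> v \<le> x i}"
    by (simp add: length_filter_conv_card cong: conj_cong)
  finally show ?thesis
    using assms sorted_desc_nth_ge_iff[of "rev (sort ?xs)" m v]
    by (simp add: losing_value_def sorted_wrt_rev)
qed

lemma losing_value_nonneg:
  assumes "\<And>i. i < N \<Longrightarrow> 0 \<le> x i"
  shows "0 \<le> losing_value m N x"
proof (cases "m < N")
  case True
  have "{i. i < N \<and> 0 \<le> x i} = {..<N}" using assms by auto
  then show ?thesis using True by (simp add: losing_value_ge_iff)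
qed (simp add: losing_value_def)

lemma losing_value_mono_agents:
  assumes "N \<le> N'" "\<And>i. i < N' \<Longrightarrow> 0 \<le> x i"
  shows "losing_value m N x \<le> losing_value m N' x"
proof (cases "m < N")
  case True
  have "card {i. i < N \<and> losing_value m N x \<le> x i} \<le> card {i. i < N' \<and> losing_value m N x \<le> x i}"
    using assms(1) by (intro card_mono) auto
  then show ?thesis
    using losing_value_ge_iff[OF True, of "losing_value m N x" x] True assms(1)
    by (auto simp: losing_value_ge_iff)
next
  \<comment> \<open>With at most \<open>m\<close> buyers the losing value is 0 by convention, so
    nonnegative values are what makes it the smaller one.\<close>
  case False
  then have "losing_value m N x = 0" by (simp add: losing_value_def)
  then show ?thesis using losing_value_nonneg assms(2) by simp
qed

lemma losing_value_cong:
  assumes "\<And>i. i < N \<Longrightarrow> x i = y i"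
  shows "losing_value m N x = losing_value m N y"
proof -
  have "map x [0..<N] = map y [0..<N]" using assms by simp
  then show ?thesis unfolding losing_value_def by presburger
qed

text \<open>The rank increases strictly along \<open>R\<close>, hence is injective; an element does
  not precede itself, hence ranks stay below \<open>card T\<close>; a cardinality count gives
  surjectivity.\<close>

lemma bij_betw_rank:
  assumes "finite T"
    and irrefl: "\<And>i. i \<in> T \<Longrightarrow> \<not> R i i"
    and trans: "\<And>i j k. R i j \<Longrightarrow> R j k \<Longrightarrow> R i k"
    and total: "\<And>i j. i \<in> T \<Longrightarrow> j \<in> T \<Longrightarrow> i \<noteq> j \<Longrightarrow> R i j \<or> R j i"
  shows "bij_betw (\<lambda>i. card {j \<in> T. R j i}) T {..<card T}"
proof -
  let ?rk = "\<lambda>i. card {j \<in> T. R j i}"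
  have less: "?rk i < ?rk j" if "i \<in> T" "j \<in> T" "R i j" for i j
  proof (rule psubset_card_mono)
    have "{k \<in> T. R k i} \<subseteq> {k \<in> T. R k j}"
      using trans[OF _ that(3)] by auto
    moreover have "i \<in> {k \<in> T. R k j} - {k \<in> T. R k i}"
      using that irrefl by simp
    ultimately show "{k \<in> T. R k i} \<subset> {k \<in> T. R k j}" by auto
  qed (use assms in auto)
  have inj: "inj_on ?rk T"
  proof (rule inj_onI, rule ccontr)
    fix i j assume "i \<in> T" "j \<in> T" "?rk i = ?rk j" "i \<noteq> j"
    then show False using total[of i j] less[of i j] less[of j i] by auto
  qed
  have sub: "?rk ` T \<subseteq> {..<card T}"
  proof clarsimp
    fix i assume "i \<in> T"
    then have "{j \<in> T. R j i} \<subset> T" using irrefl by blast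
    then show "?rk i < card T" using assms(1) by (rule psubset_card_mono[rotated])
  qed
  have "?rk ` T = {..<card T}"
    by (rule card_subset_eq) (use sub inj in \<open>auto simp: card_image\<close>)
  then show ?thesis using inj by (simp add: bij_betw_def)
qed

text \<open>Whoever beats a buyer with value at least \<open>p\<close> also has value at least
  \<open>p\<close>, so ranks can be computed inside \<open>T\<close>, where they exhaust the numbers
  below \<open>card T\<close>. The index tie-break makes the order total.\<close>

lemma card_winners_above:
  "card {i \<in> winners m N x. p \<le> x i} = min m (card {i. i < N \<and> p \<le> x i})"
proof -
  define R where "R = (\<lambda>j i. x j > x i \<or> x j = x i \<and> j < (i::nat))"
  define T where "T = {i. i < N \<and> p \<le> x i}"
  let ?rk = "\<lambda>i. card {j \<in> T. R j i}"
  have bij: "bij_betw ?rk T {..<card T}"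
    by (rule bij_betw_rank) (auto simp: R_def T_def)
  have up: "{j. j < N \<and> R j i} = {j \<in> T. R j i}" if "i \<in> T" for i
    using that by (auto simp: R_def T_def)
  have "{i \<in> winners m N x. p \<le> x i} = {i \<in> T. card {j. j < N \<and> R j i} < m}"
    by (auto simp: winners_def T_def R_def)
  also have "\<dots> = {i \<in> T. ?rk i < m}" using up by auto
  finally have eq: "{i \<in> winners m N x. p \<le> x i} = {i \<in> T. ?rk i < m}" .
  have "?rk ` {i \<in> T. ?rk i < m} = ?rk ` T \<inter> {..<m}" by auto
  also have "\<dots> = {..<min m (card T)}" using bij by (auto simp: bij_betw_def)
  finally have "?rk ` {i \<in> T. ?rk i < m} = {..<min m (card T)}" .
  moreover have "inj_on ?rk {i \<in> T. ?rk i < m}"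
    using bij by (auto simp: bij_betw_def intro: inj_on_subset)
  ultimately show ?thesis
    using card_image[of ?rk "{i \<in> T. ?rk i < m}"] by (simp add: eq T_def)
qed

lemma VCG_payment_eq:
  assumes "m \<le> N"
  shows "VCG_payment m N x = m * losing_value m N x"
proof -
  \<comment> \<open>A threshold that every value reaches, so that all winners are counted; the
    inserted 0 keeps the set nonempty for \<open>N = 0\<close>.\<close>
  define p where "p = Min (insert 0 (x ` {..<N}))"
  have p: "p \<le> x i" if "i < N" for i using that by (auto simp: p_def)
  have "{i \<in> winners m N x. p \<le> x i} = winners m N x" "{i. i < N \<and> p \<le> x i} = {..<N}"
    using p by (auto simp: winners_def)
  then have "card (winners m N x) = m"
    using card_winners_above[of m N x p] assms by simp
  then show ?thesis by (simp add: VCG_payment_def)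
qed

text \<open>Each sale pays \<open>p\<close> plus the excess of the losing value over
  \<open>p\<close>. A positive excess means that more than \<open>m\<close> buyers reach
  \<open>p\<close>, so all \<open>m\<close> units are sold and the excess is always multiplied by
  \<open>m\<close>.\<close>

lemma OPT_payment_eq:
  fixes p :: real
  assumes "0 \<le> p"
  shows "OPT_payment m N p x =
    p * min m (card {i. i < N \<and> p \<le> x i}) + m * max (losing_value m N x - p) 0"
proof (cases "losing_value m N x \<le> p")
  case True
  then show ?thesis by (simp add: OPT_payment_def card_winners_above max_def)
next
  case False
  then have "m < N" using assms by (auto simp: losing_value_def split: if_splits)
  with False have "m < card {i. i < N \<and> p \<le> x i}"
    using losing_value_ge_iff[of m N p x] by simp
  then show ?thesis using False
    by (simp add: OPT_payment_def card_winners_above algebra_simps)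
qed

section \<open>Measurability and integrability of the losing value\<close>

lemma component_measurable:
  assumes "sets F = sets M" "i \<in> I"
  shows "(\<lambda>x. x i) \<in> measurable (\<Pi>\<^sub>M i\<in>I. F) M"
  using measurable_component_singleton[OF assms(2), of "\<lambda>_. F"] measurable_cong_sets[OF refl assms(1)]
  by blast

lemma card_above_measurable:
  fixes F :: "real measure" and N :: nat
  assumes "sets F = sets borel"
  shows "(\<lambda>x. real (card {i. i < N \<and> v \<le> x i})) \<in> borel_measurable (\<Pi>\<^sub>M i\<in>{..<N}. F)"
proof -
  have "real (card {i. i < N \<and> v \<le> x i}) = (\<Sum>i<N. indicator {v..} (x i))" for x :: "nat \<Rightarrow> real"
  proof -
    have "(\<Sum>i<N. indicator {v..} (x i)) = (\<Sum>i<N. if v \<le> x i then 1 else (0::real))"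
      by (intro sum.cong) auto
    also have "\<dots> = real (card ({..<N} \<inter> {i. v \<le> x i}))"
      by (subst sum.If_cases) auto
    also have "{..<N} \<inter> {i. v \<le> x i} = {i. i < N \<and> v \<le> x i}" by auto
    finally show ?thesis by simp
  qed
  moreover have "(\<lambda>x::nat \<Rightarrow> real. \<Sum>i<N. indicator {v..} (x i) :: real) \<in> borel_measurable (\<Pi>\<^sub>M i\<in>{..<N}. F)"
    by (intro borel_measurable_sum measurable_compose[OF component_measurable[OF assms]]
      borel_measurable_indicator) auto
  ultimately show ?thesis by presburger
qed

lemma losing_value_measurable:
  fixes F :: "real measure"
  assumes "sets F = sets borel"
  shows "losing_value m N \<in> borel_measurable (\<Pi>\<^sub>M i\<in>{..<N}. F)"
proof (cases "m < N")
  case True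
  let ?M = "\<Pi>\<^sub>M i\<in>{..<N}. F"
  have "{x \<in> space ?M. v \<le> losing_value m N x} \<in> sets ?M" for v
  proof -
    have "{x \<in> space ?M. real m < real (card {i. i < N \<and> v \<le> x i})} \<in> sets ?M"
      by (rule borel_measurable_less[OF borel_measurable_const card_above_measurable[OF assms]])
    then show ?thesis by (simp only: losing_value_ge_iff[OF True] of_nat_less_iff)
  qed
  then show ?thesis by (rule borel_measurable_iff_ge[THEN iffD2, OF allI])
next
  case False
  then have "losing_value m N = (\<lambda>x. 0)" by (auto simp: losing_value_def)
  then show ?thesis by simp
qed

lemma ennreal_le_suminf: "f k \<le> (\<Sum>k. f k)" for f :: "nat \<Rightarrow> ennreal"
  using sum_le_suminf[of f "{k}"] by simp

text \<open>A tail \<open>C / v\<close> allows an infinite mean, but the square root then has a tail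
  of order \<open>C / t^2\<close>. Cutting at the powers of 4 leaves a geometric series of ratio
  1/2.\<close>

lemma integrable_sqrt_of_tail:
  fixes F :: "real measure"
  assumes "prob_space F" and sets: "sets F = sets borel" and neg: "measure F {..<0} = 0"
    and tail: "\<And>v. 0 < v \<Longrightarrow> measure F {v..} \<le> C / v"
  shows "integrable F sqrt"
proof -
  interpret prob_space F by fact
  have [measurable_cong]: "sets F = sets borel" by fact
  have C: "0 \<le> C" using tail[of 1] by (simp add: order_trans[OF measure_nonneg])
  have nonneg: "AE x in F. 0 \<le> x"
    by (rule AE_I[of _ _ "{..<0}"]) (auto simp: sets neg emeasure_eq_measure)
  \<comment> \<open>Between \<open>4 ^ k\<close> and \<open>4 ^ Suc k\<close> the root is at most
    \<open>2 ^ Suc k\<close>; the summand 1 covers \<open>x < 1\<close>.\<close>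
  let ?g = "\<lambda>x::real. 1 + (\<Sum>k. ennreal (2 ^ Suc k) * indicator {4 ^ k..} x)"
  have bound: "ennreal (sqrt x) \<le> ?g x" if "0 \<le> x" for x
  proof (cases "x < 1")
    case True
    then have "ennreal (sqrt x) \<le> 1" by (simp add: that)
    then show ?thesis by (rule order_trans) simp
  next
    case False
    define n where "n = (LEAST n. x < 4 ^ n)"
    have ex: "\<exists>n. x < 4 ^ n" using real_arch_pow[of 4 x] by simp
    then have xn: "x < 4 ^ n" unfolding n_def by (rule LeastI_ex)
    then have "n \<noteq> 0" using False by (intro notI) simp
    then obtain k where k: "n = Suc k" by (cases n) auto
    have "4 ^ k \<le> x" using not_less_Least[of k "\<lambda>n. x < 4 ^ n"] k n_def by simp
    moreover have "sqrt x \<le> 2 ^ Suc k"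
    proof (rule real_le_lsqrt)
      have "(2 ^ Suc k)\<^sup>2 = ((2::real)\<^sup>2) ^ Suc k"
        by (simp only: mult.commute flip: power_mult)
      then show "x \<le> (2 ^ Suc k)\<^sup>2" using xn k by simp
    qed (use that in auto)
    ultimately have "ennreal (sqrt x) \<le> ennreal (2 ^ Suc k) * indicator {4 ^ k..} x"
      by (simp add: ennreal_leI)
    also have "\<dots> \<le> (\<Sum>k. ennreal (2 ^ Suc k) * indicator {4 ^ k..} x)"
      by (rule ennreal_le_suminf)
    also have "\<dots> \<le> ?g x" by simp
    finally show ?thesis .
  qed
  have "AE x in F. ennreal (norm (sqrt x)) \<le> ?g x"
    using nonneg
  proof eventually_elim
    case (elim x)
    then show ?case
      using bound[OF elim] by (simp only: real_norm_def abs_of_nonneg real_sqrt_ge_zero)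
  qed
  then have "(\<integral>\<^sup>+x. ennreal (norm (sqrt x)) \<partial>F) \<le> (\<integral>\<^sup>+x. ?g x \<partial>F)"
    by (rule nn_integral_mono_AE)
  also have "\<dots> = 1 + (\<Sum>k. ennreal (2 ^ Suc k) * emeasure F {4 ^ k..})"
    by (simp add: nn_integral_add nn_integral_suminf nn_integral_cmult_indicator sets emeasure_space_1)
  also have "\<dots> \<le> 1 + (\<Sum>k. ennreal (2 * C * (1 / 2) ^ k))"
  proof (intro add_left_mono suminf_le)
    fix k
    have "2 ^ Suc k * measure F {4 ^ k..} \<le> 2 ^ Suc k * (C / 4 ^ k)"
      by (intro mult_left_mono tail) auto
    also have "\<dots> = 2 * C * (1 / 2) ^ k"
      by (simp add: field_simps flip: power_mult_distrib)
    finally show "ennreal (2 ^ Suc k) * emeasure F {4 ^ k..} \<le> ennreal (2 * C * (1 / 2) ^ k)"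
      by (simp add: emeasure_eq_measure ennreal_leI flip: ennreal_mult)
  qed auto
  also have "(\<Sum>k. ennreal (2 * C * (1 / 2) ^ k)) = ennreal (\<Sum>k. 2 * C * (1 / 2) ^ k)"
    by (rule suminf_ennreal2) (auto simp: C intro: summable_mult summable_geometric)
  finally have "(\<integral>\<^sup>+x. ennreal (norm (sqrt x)) \<partial>F) < \<infinity>"
    by (rule le_less_trans) (simp add: ennreal_add_less_top ennreal_less_top)
  then show ?thesis by (intro integrableI_bounded) auto
qed

text \<open>As \<open>1 \<le> m\<close>, two distinct buyers reach the losing value
  \<open>v\<close>, so \<open>v = sqrt v * sqrt v\<close> is at most a product of roots of two
  independent values, which has finite mean. The bound \<open>?B\<close> sums over all pairs because
  the pair depends on the profile.\<close>

lemma integrable_losing_value: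
  fixes F :: "real measure"
  assumes "prob_space F" and sets: "sets F = sets borel" and neg: "measure F {..<0} = 0"
    and tail: "\<And>v. 0 < v \<Longrightarrow> measure F {v..} \<le> C / v" and "1 \<le> m"
  shows "integrable (\<Pi>\<^sub>M i\<in>{..<N}. F) (losing_value m N)"
proof (cases "m < N")
  case True
  interpret prob_space F by fact
  interpret P: product_prob_space "\<lambda>_. F" "{..<N}" ..
  have nonneg1: "AE x in F. 0 \<le> x"
    by (rule AE_I[of _ _ "{..<0}"]) (auto simp: sets neg emeasure_eq_measure)
  have nonneg: "AE x in (\<Pi>\<^sub>M i\<in>{..<N}. F). \<forall>i\<in>{..<N}. 0 \<le> x i"
    using nonneg1 by (intro AE_ball_countable[THEN iffD2] ballI AE_PiM_component)
      (auto simp: assms(1))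
  let ?B = "\<lambda>x. \<Sum>i<N. \<Sum>j\<in>{..<N}-{i}. sqrt (x i) * sqrt (x j)"
  have "integrable (\<Pi>\<^sub>M i\<in>{..<N}. F) ?B"
  proof (intro Bochner_Integration.integrable_sum)
    fix i j assume ij: "i \<in> {..<N}" "j \<in> {..<N} - {i}"
    have "integrable (\<Pi>\<^sub>M i\<in>{..<N}. F) (\<lambda>x. \<Prod>k<N. (if k \<in> {i, j} then sqrt else (\<lambda>_. 1)) (x k))"
      using integrable_sqrt_of_tail[OF assms(1-4)] by (intro P.product_integrable_prod) auto
    also have "(\<lambda>x. \<Prod>k<N. (if k \<in> {i, j} then sqrt else (\<lambda>_. 1)) (x k)) =
      (\<lambda>x. sqrt (x i) * sqrt (x j))"
    proof
      fix x :: "nat \<Rightarrow> real"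
      have "(\<Prod>k<N. (if k \<in> {i, j} then sqrt else (\<lambda>_. 1)) (x k)) =
          (\<Prod>k<N. if k \<in> {i, j} then sqrt (x k) else 1)"
        by (intro prod.cong) auto
      also have "\<dots> = (\<Prod>k\<in>{..<N} \<inter> {i, j}. sqrt (x k))"
        by (rule prod.inter_restrict[symmetric]) auto
      also have "{..<N} \<inter> {i, j} = {i, j}" using ij by auto
      finally show "(\<Prod>k<N. (if k \<in> {i, j} then sqrt else (\<lambda>_. 1)) (x k)) = sqrt (x i) * sqrt (x j)"
        using ij by auto
    qed
    finally show "integrable (\<Pi>\<^sub>M i\<in>{..<N}. F) (\<lambda>x. sqrt (x i) * sqrt (x j))" .
  qed
  moreover have "losing_value m N x \<le> ?B x" "0 \<le> losing_value m N x" if x: "\<forall>i\<in>{..<N}. 0 \<le> x i" for x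
  proof -
    define v where "v = losing_value m N x"
    show v0: "0 \<le> losing_value m N x" using x by (intro losing_value_nonneg) auto
    have "2 \<le> card {i. i < N \<and> v \<le> x i}"
      using losing_value_ge_iff[OF True, of v x] \<open>1 \<le> m\<close> by (simp add: v_def)
    then obtain i j where ij: "i \<noteq> j" "i < N" "j < N" "v \<le> x i" "v \<le> x j"
      by (auto simp: card_le_Suc_iff numeral_2_eq_2)
    have "v = sqrt v * sqrt v" using v0 v_def by simp
    also have "\<dots> \<le> sqrt (x i) * sqrt (x j)"
      using ij v0 v_def by (intro mult_mono) auto
    also have "\<dots> \<le> (\<Sum>j\<in>{..<N}-{i}. sqrt (x i) * sqrt (x j))"
      by (rule member_le_sum) (use ij x in auto)
    also have "\<dots> \<le> ?B x"
      by (rule member_le_sum) (use ij x in \<open>auto intro!: sum_nonneg\<close>)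
    finally show "losing_value m N x \<le> ?B x" by (simp add: v_def)
  qed
  ultimately show ?thesis
    using nonneg by (elim Bochner_Integration.integrable_bound)
      (auto simp: losing_value_measurable sets elim!: eventually_mono intro: order_trans[OF _ abs_ge_self])
next
  case False
  then have "losing_value m N = (\<lambda>x. 0)" by (auto simp: losing_value_def)
  then show ?thesis by simp
qed

section \<open>Tails with constant virtual value\<close>

text \<open>Over \<open>n + 1\<close> equal steps the possible losses add up to
  \<open>C * (b - a)^2 / (n + 1)\<close>, which tends to 0. This replaces a sign condition on a
  derivative that need not exist.\<close>

lemma mono_of_quadratic_increments:
  fixes \<psi> :: "real \<Rightarrow> real"
  assumes "a \<le> b" and inc: "\<And>u v. a \<le> u \<Longrightarrow> u < v \<Longrightarrow> v \<le> b \<Longrightarrow> - C * (v - u)\<^sup>2 \<le> \<psi> v - \<psi> u"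
  shows "\<psi> a \<le> \<psi> b"
proof (cases "a = b")
  case False
  then have ab: "a < b" using assms by simp
  have "- C * (b - a)\<^sup>2 * inverse (real (Suc n)) \<le> \<psi> b - \<psi> a" for n
  proof -
    define d where "d = (b - a) / Suc n"
    have d: "0 < d" "Suc n * d = b - a" using ab by (auto simp: d_def)
    have "(\<Sum>i<Suc n. - C * d\<^sup>2) \<le> (\<Sum>i<Suc n. \<psi> (a + Suc i * d) - \<psi> (a + i * d))"
    proof (rule sum_mono)
      fix i assume "i \<in> {..<Suc n}"
      then have "Suc i * d \<le> Suc n * d" using d by (intro mult_right_mono) auto
      then have "- C * ((a + Suc i * d) - (a + i * d))\<^sup>2 \<le> \<psi> (a + Suc i * d) - \<psi> (a + i * d)"
        using d by (intro inc) (auto simp: algebra_simps)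
      then show "- C * d\<^sup>2 \<le> \<psi> (a + Suc i * d) - \<psi> (a + i * d)"
        by (simp add: algebra_simps)
    qed
    also have "\<dots> = \<psi> (a + Suc n * d) - \<psi> (a + 0 * d)"
      by (subst sum_lessThan_telescope) simp
    also have "\<dots> = \<psi> b - \<psi> a" using d by simp
    also have "(\<Sum>i<Suc n. - C * d\<^sup>2) = - C * ((Suc n * d) * (Suc n * d)) * inverse (real (Suc n))"
      by (simp add: power2_eq_square field_simps)
    finally show ?thesis by (simp only: d power2_eq_square mult.assoc)
  qed
  moreover have "(\<lambda>n. - C * (b - a)\<^sup>2 * inverse (real (Suc n))) \<longlonglongrightarrow> - C * (b - a)\<^sup>2 * 0"
    by (intro tendsto_intros LIMSEQ_inverse_real_of_nat)
  ultimately have "- C * (b - a)\<^sup>2 * 0 \<le> \<psi> b - \<psi> a"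
    by (intro tendsto_upperbound[OF _ always_eventually]) auto
  then show ?thesis by simp
qed simp

text \<open>The derivative condition says that the hazard rate is
  \<open>1 / (l * v + \<kappa>)\<close>, that is, the virtual value is constantly
  \<open>- \<kappa>\<close>. Working from it instead of the explicit formula covers rescaled tails
  as well.\<close>

locale tail_curve =
  fixes G :: "real \<Rightarrow> real" and l \<kappa> :: real
  assumes G_0: "G 0 = 1" and G_pos: "\<And>v. 0 \<le> v \<Longrightarrow> 0 < G v"
    and l: "0 \<le> l" "l \<le> 1" and \<kappa>: "0 < \<kappa>"
    and G_deriv: "\<And>v. 0 \<le> v \<Longrightarrow> (G has_real_derivative - G v / (l * v + \<kappa>)) (at v)"
begin

lemma denom_pos: "0 \<le> v \<Longrightarrow> 0 < l * v + \<kappa>"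
  using l \<kappa> by (simp add: add_nonneg_pos)

lemma G_strict_antimono: "0 \<le> u \<Longrightarrow> u < v \<Longrightarrow> G v < G u"
  by (rule DERIV_neg_imp_decreasing)
    (auto intro!: exI[where x="- G x / (l * x + \<kappa>)" for x] G_deriv divide_pos_pos G_pos denom_pos)

lemma G_antimono: "0 \<le> u \<Longrightarrow> u \<le> v \<Longrightarrow> G v \<le> G u"
  using G_strict_antimono[of u v] by (cases "u = v") auto

lemma G_less_iff: "0 \<le> u \<Longrightarrow> 0 \<le> v \<Longrightarrow> G v < G u \<longleftrightarrow> u < v"
  by (metis G_antimono G_strict_antimono not_le)

lemma G_le_1: "0 \<le> v \<Longrightarrow> G v \<le> 1"
  using G_antimono[of 0 v] by (simp add: G_0)

lemma continuous_on_G: "A \<subseteq> {0..} \<Longrightarrow> continuous_on A G"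
  by (meson DERIV_isCont G_deriv atLeast_iff continuous_at_imp_continuous_on subsetD)

text \<open>The density that belongs to the tail \<open>G\<close>.\<close>

definition slope :: "real \<Rightarrow> real" where "slope v = G v / (l * v + \<kappa>)"

text \<open>The derivative of the density is \<open>- (1 + l) * G v / (l * v + \<kappa>)^2\<close>,
  and \<open>1 + l \<le> 2\<close>, \<open>G v \<le> 1\<close>. This is the source of the quadratic
  errors in the ratio lemmas.\<close>

lemma slope_lipschitz:
  assumes "0 \<le> u" "u < v"
  shows "(v - u) * (slope u - slope v) \<le> 2 / \<kappa>\<^sup>2 * (v - u)\<^sup>2"
proof -
  define D where "D v = - (1 + l) * G v / (l * v + \<kappa>)\<^sup>2" for v
  have "(slope has_real_derivative D v) (at v)" if "0 \<le> v" for v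
    unfolding slope_def using denom_pos[OF that]
    by (auto intro!: derivative_eq_intros G_deriv[OF that]
      simp: D_def divide_simps power2_eq_square) (auto simp: algebra_simps)
  then obtain z where z: "u < z" "z < v" "slope v - slope u = (v - u) * D z"
    using MVT2[OF assms(2), of slope D] assms(1) by force
  have "0 \<le> z" "0 \<le> l * z" using z assms l by auto
  then have "(1 + l) * G z / (l * z + \<kappa>)\<^sup>2 \<le> 2 * 1 / \<kappa>\<^sup>2"
    using l \<kappa> G_le_1[of z] G_pos[of z] by (intro frac_le mult_mono power_mono) auto
  moreover have "- D z = (1 + l) * G z / (l * z + \<kappa>)\<^sup>2"
    unfolding D_def by (simp only: mult_minus_left minus_divide_left minus_minus)
  ultimately have "(v - u)\<^sup>2 * - D z \<le> (v - u)\<^sup>2 * (2 / \<kappa>\<^sup>2)" by (intro mult_left_mono) auto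
  moreover have "slope u - slope v = (v - u) * - D z" using z(3) by linarith
  ultimately show ?thesis by (simp only: power2_eq_square mult_ac)
qed

lemma slope_antimono: "0 \<le> u \<Longrightarrow> u \<le> v \<Longrightarrow> slope v \<le> slope u"
  unfolding slope_def using l \<kappa>
  by (intro frac_le G_antimono) (auto intro: less_imp_le G_pos denom_pos mult_left_mono)

lemma G_diff:
  assumes "0 \<le> u" "u < v"
  shows "(v - u) * slope v \<le> G u - G v" "G u - G v \<le> (v - u) * slope u"
proof -
  obtain z where z: "u < z" "z < v" "G v - G u = (v - u) * (- slope z)"
    using MVT2[OF assms(2), of G "\<lambda>z. - slope z"] G_deriv assms(1) by (force simp: slope_def)
  then show "(v - u) * slope v \<le> G u - G v" "G u - G v \<le> (v - u) * slope u"
    using slope_antimono[of z v] slope_antimono[of u z] assms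
    by (smt (verit) mult_left_mono mult_minus_right)+
qed

text \<open>The hypotheses compare hazard rates.  That of \<open>y\<close> enters only through increments, because
  a density is determined only up to null sets and \<open>y\<close> need not be differentiable.\<close>

lemma ratio_mono:
  assumes "0 \<le> a" "a \<le> b" and y: "\<And>v. a \<le> v \<Longrightarrow> v \<le> b \<Longrightarrow> 0 \<le> y v \<and> y v \<le> 1"
    and inc: "\<And>u v. a \<le> u \<Longrightarrow> u < v \<Longrightarrow> v \<le> b \<Longrightarrow> y u - y v \<le> (v - u) * (y u / (l * u + \<kappa>))"
  shows "y a / G a \<le> y b / G b"
\<comment> \<open>The cross difference \<open>y v * G u - y u * G v\<close> is at least
  \<open>- 2 / \<kappa>^2 * (v - u)^2\<close>; dividing by \<open>G u * G v\<close>, which is at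
  least \<open>G b * G b\<close>, produces \<open>C\<close>.\<close>
proof (rule mono_of_quadratic_increments[where \<psi> = "\<lambda>x. y x / G x" and a = a and b = b and C = "2 / \<kappa>\<^sup>2 / (G b * G b)"])
  fix u v assume uv: "a \<le> u" "u < v" "v \<le> b"
  let ?L = "2 / \<kappa>\<^sup>2" and ?d = "v - u"
  have pos: "0 < G u" "0 < G v" "0 < G b" using uv assms(1) by (auto intro!: G_pos)
  have yu: "0 \<le> y u" "y u \<le> 1" using y[of u] uv by auto
  have "?d * (slope v - slope u) = - (?d * (slope u - slope v))" by (simp add: algebra_simps)
  then have "y u * (- ?L * ?d\<^sup>2) \<le> y u * (?d * (slope v - slope u))"
    using slope_lipschitz[of u v] uv assms(1) by (intro mult_left_mono yu) auto
  also have "\<dots> \<le> y u * (G u - G v - ?d * slope u)"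
    using G_diff(1)[of u v] uv assms(1) by (intro mult_left_mono yu) (auto simp: algebra_simps)
  also have "\<dots> = (y u - ?d * (y u / (l * u + \<kappa>))) * G u - y u * G v"
    by (simp add: slope_def algebra_simps)
  also have "\<dots> \<le> y v * G u - y u * G v"
    using inc[OF uv] pos by (intro diff_right_mono mult_right_mono) auto
  finally have *: "y u * (- ?L * ?d\<^sup>2) \<le> y v * G u - y u * G v" .
  have "- ?L * ?d\<^sup>2 \<le> y u * (- ?L * ?d\<^sup>2)"
    using yu mult_right_mono[of "y u" 1 "?L * ?d\<^sup>2"] by simp
  with * have "- ?L * ?d\<^sup>2 \<le> y v * G u - y u * G v" by linarith
  then have "- ?L * ?d\<^sup>2 / (G u * G v) \<le> (y v * G u - y u * G v) / (G u * G v)"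
    using pos by (intro divide_right_mono) auto
  also have "\<dots> = y v / G v - y u / G u" using pos by (simp add: field_simps)
  finally have "- (?L * ?d\<^sup>2 / (G u * G v)) \<le> y v / G v - y u / G u" by simp
  moreover have "?L * ?d\<^sup>2 / (G u * G v) \<le> ?L * ?d\<^sup>2 / (G b * G b)"
    using pos uv assms(1) \<kappa> by (intro divide_left_mono mult_mono G_antimono) auto
  ultimately show "- (?L / (G b * G b)) * ?d\<^sup>2 \<le> y v / G v - y u / G u"
    by simp
qed (use assms in auto)

text \<open>The same estimate for \<open>- (y / G)\<close>. Now the decrement of \<open>y\<close> is
  bounded from below, so the hazard term sits at the right end \<open>v\<close>, where a
  non-increasing tail over \<open>l * v + \<kappa>\<close> is smallest.\<close>

lemma ratio_antimono:
  assumes "0 \<le> a" "a \<le> b" and y: "\<And>v. a \<le> v \<Longrightarrow> v \<le> b \<Longrightarrow> 0 \<le> y v \<and> y v \<le> 1"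
    and inc: "\<And>u v. a \<le> u \<Longrightarrow> u < v \<Longrightarrow> v \<le> b \<Longrightarrow> (v - u) * (y v / (l * v + \<kappa>)) \<le> y u - y v"
  shows "y b / G b \<le> y a / G a"
proof -
  have "- (y a / G a) \<le> - (y b / G b)"
  proof (rule mono_of_quadratic_increments[where \<psi> = "\<lambda>x. - (y x / G x)" and a = a and b = b and C = "2 / \<kappa>\<^sup>2 / (G b * G b)"])
    fix u v assume uv: "a \<le> u" "u < v" "v \<le> b"
    let ?L = "2 / \<kappa>\<^sup>2" and ?d = "v - u"
    have pos: "0 < G u" "0 < G v" "0 < G b" using uv assms(1) by (auto intro!: G_pos)
    have yv: "0 \<le> y v" "y v \<le> 1" using y[of v] uv by auto
    have "y v * G u - y u * G v \<le> y v * G u - (y v + ?d * (y v / (l * v + \<kappa>))) * G v"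
      using inc[OF uv] pos by (intro diff_left_mono mult_right_mono) auto
    also have "\<dots> = y v * (G u - G v - ?d * slope v)"
      by (simp add: slope_def algebra_simps)
    also have "\<dots> \<le> y v * (?d * (slope u - slope v))"
      using G_diff(2)[of u v] uv assms(1) by (intro mult_left_mono yv) (auto simp: algebra_simps)
    also have "\<dots> \<le> y v * (?L * ?d\<^sup>2)"
      using slope_lipschitz[of u v] uv assms(1) by (intro mult_left_mono yv) auto
    also have "\<dots> \<le> ?L * ?d\<^sup>2"
      using yv mult_right_mono[of "y v" 1 "?L * ?d\<^sup>2"] by simp
    finally have "(y v * G u - y u * G v) / (G u * G v) \<le> ?L * ?d\<^sup>2 / (G u * G v)"
      using pos by (intro divide_right_mono) auto
    moreover have "(y v * G u - y u * G v) / (G u * G v) = y v / G v - y u / G u"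
      using pos by (simp add: field_simps)
    moreover have "?L * ?d\<^sup>2 / (G u * G v) \<le> ?L * ?d\<^sup>2 / (G b * G b)"
      using pos uv assms(1) \<kappa> by (intro divide_left_mono mult_mono G_antimono) auto
    ultimately show "- (?L / (G b * G b)) * ?d\<^sup>2 \<le> - (y v / G v) - - (y u / G u)"
      by simp
  qed (use assms in auto)
  then show ?thesis by simp
qed

text \<open>The derivative of \<open>x * G x\<close> has the sign of
  \<open>\<kappa> - (1 - l) * x\<close>; the first hypothesis says that \<open>r\<close> does not
  lie beyond the peak of the revenue.\<close>

lemma revenue_mono:
  assumes "(1 - l) * r \<le> \<kappa>" "0 \<le> u" "u \<le> v" "v \<le> r"
  shows "u * G u \<le> v * G v"
proof (rule DERIV_nonneg_imp_nondecreasing[OF assms(3)])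
  fix x assume x: "u \<le> x" "x \<le> v"
  then have "0 \<le> x" "(1 - l) * x \<le> (1 - l) * r" using assms l by (auto intro: mult_left_mono)
  moreover have "0 < G x" "0 < l * x + \<kappa>" using \<open>0 \<le> x\<close> by (auto intro: G_pos denom_pos)
  ultimately have "0 \<le> G x * (\<kappa> - (1 - l) * x) / (l * x + \<kappa>)"
    using assms(1) by (intro divide_nonneg_pos mult_nonneg_nonneg) auto
  moreover have "((\<lambda>x. x * G x) has_real_derivative G x * (\<kappa> - (1 - l) * x) / (l * x + \<kappa>)) (at x)"
    using \<open>0 < l * x + \<kappa>\<close>
    by (auto intro!: derivative_eq_intros G_deriv[OF \<open>0 \<le> x\<close>] simp: divide_simps)
      (auto simp: algebra_simps)
  ultimately show "\<exists>y. ((\<lambda>x. x * G x) has_real_derivative y) (at x) \<and> 0 \<le> y" by blast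
qed

text \<open>Here the peak lies before \<open>r\<close>: the revenue has negative derivative at
  \<open>r\<close>, so a slightly lower price earns more. Bounding the step by \<open>r / 2\<close>
  keeps that price positive.\<close>

lemma revenue_not_max:
  assumes "\<kappa> < (1 - l) * r" "0 < r"
  shows "\<exists>v. 0 < v \<and> v < r \<and> r * G r < v * G v"
proof -
  have pos: "0 < G r" "0 < l * r + \<kappa>" using assms by (auto intro: G_pos denom_pos)
  have "((\<lambda>x. x * G x) has_real_derivative G r * (\<kappa> - (1 - l) * r) / (l * r + \<kappa>)) (at r)"
    using pos assms by (auto intro!: derivative_eq_intros G_deriv simp: divide_simps)
      (auto simp: algebra_simps)
  moreover have "G r * (\<kappa> - (1 - l) * r) / (l * r + \<kappa>) < 0"
    using pos assms by (auto simp: divide_less_0_iff mult_less_0_iff)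
  ultimately obtain d where d: "d > 0" "\<And>h. 0 < h \<Longrightarrow> h < d \<Longrightarrow> r * G r < (r - h) * G (r - h)"
    using DERIV_neg_dec_left by blast
  define h where "h = min (d / 2) (r / 2)"
  show ?thesis using d(2)[of h] d(1) assms by (intro exI[of _ "r - h"]) (auto simp: h_def min_def)
qed

end

text \<open>Not truncated at \<open>r\<close>, so that it is differentiable there; the revenue
  argument needs the derivative at \<open>r\<close>.\<close>

definition gpd_tail :: "real \<Rightarrow> real \<Rightarrow> real \<Rightarrow> real" where
  "gpd_tail l r v =
     (if l = 0 then r powr (- v / r) else ((r powr l - 1) / r * v + 1) powr (- 1 / l))"

text \<open>The constant for which the hazard rate of the tail is \<open>1 / (l * v + gpd_kappa l r)\<close>; the
  virtual value is then the constant \<open>- gpd_kappa l r\<close>.\<close>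

definition gpd_kappa :: "real \<Rightarrow> real \<Rightarrow> real" where
  "gpd_kappa l r = (if l = 0 then r / ln r else l * r / (r powr l - 1))"

lemma gpd_CDF_eq: "gpd_CDF l r v = (if v > r then 1 else 1 - gpd_tail l r v)"
  by (simp add: gpd_CDF_def gpd_tail_def)

lemma gpd_tail_1: "gpd_tail l 1 v = 1"
  by (simp add: gpd_tail_def)

lemma gpd_tail_r:
  assumes "0 \<le> l" "1 \<le> r"
  shows "gpd_tail l r r = 1 / r"
  using assms by (auto simp: gpd_tail_def powr_powr powr_minus_divide)

text \<open>For \<open>r = 1\<close> the tail is constant and its hazard rate vanishes, which no
  finite \<open>\<kappa>\<close> describes; hence \<open>1 < r\<close> here and a separate case
  \<open>r = 1\<close> throughout.\<close>

lemma gpd_tail_curve: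
  assumes "0 \<le> l" "l \<le> 1" "1 < r"
  shows "tail_curve (gpd_tail l r) l (gpd_kappa l r)"
proof (cases "l = 0")
  case True
  have "((\<lambda>v. r powr (- v / r)) has_real_derivative - (r powr (- v / r)) * ln r / r) (at v)" for v
    using assms by (auto intro!: derivative_eq_intros simp: field_simps)
  moreover have "gpd_tail l r = (\<lambda>v. r powr (- v / r))"
    using True by (auto simp: gpd_tail_def)
  ultimately show ?thesis using assms True
    by unfold_locales (auto simp: gpd_kappa_def field_simps)
next
  case False
  with assms have l: "0 < l" by simp
  define c where "c = (r powr l - 1) / r"
  have "1 < r powr l" using assms l by (simp add: gr_one_powr)
  then have c: "0 < c" using assms by (simp add: c_def)
  have kappa: "gpd_kappa l r = l / c" using False assms by (simp add: gpd_kappa_def c_def)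
  have tail: "gpd_tail l r = (\<lambda>v. (c * v + 1) powr (- 1 / l))"
    using False by (auto simp: gpd_tail_def c_def)
  have pos: "0 < c * v + 1" if "0 \<le> v" for v using that c by (simp add: add_nonneg_pos)
  have deriv: "((\<lambda>v. (c * v + 1) powr (- 1 / l)) has_real_derivative
      - ((c * v + 1) powr (- 1 / l)) / (l * v + l / c)) (at v)" if "0 \<le> v" for v
  proof -
    have "((\<lambda>v. (c * v + 1) powr (- 1 / l)) has_real_derivative
        (- 1 / l) * (c * v + 1) powr (- 1 / l - 1) * c) (at v)"
      using pos[OF that] by (auto intro!: derivative_eq_intros)
    also have "(c * v + 1) powr (- 1 / l - 1) = (c * v + 1) powr (- 1 / l) / (c * v + 1)"
      using pos[OF that] by (simp add: powr_diff)
    also have "(- 1 / l) * ((c * v + 1) powr (- 1 / l) / (c * v + 1)) * c =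
        - ((c * v + 1) powr (- 1 / l)) / (l * v + l / c)"
    proof -
      have "l * v + l / c = (l * (c * v + 1)) / c" using c by (simp add: field_simps)
      then show ?thesis by simp
    qed
    finally show ?thesis .
  qed
  show ?thesis
    unfolding tail kappa
    using assms l c pos deriv by unfold_locales (auto simp: less_imp_neq[symmetric])
qed

lemma gpd_range_ge_1: "0 \<le> l \<Longrightarrow> l \<le> 1 \<Longrightarrow> r \<in> gpd_range l \<Longrightarrow> 1 \<le> r"
  by (auto simp: gpd_range_def split: if_splits)

text \<open>Raising the endpoint of the range to the power \<open>l\<close> turns the bound into
  \<open>r powr l \<le> 1 / (1 - l)\<close>, which rearranges to the claim; for \<open>l = 0\<close>
  it is \<open>ln r \<le> 1\<close>. Thus the range consists of the parameters whose revenue does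
  not peak before \<open>r\<close>.\<close>

lemma gpd_range_iff:
  assumes "0 \<le> l" "l \<le> 1" "1 < r"
  shows "r \<in> gpd_range l \<longleftrightarrow> (1 - l) * r \<le> gpd_kappa l r"
proof -
  consider "l = 0" | "l = 1" | "0 < l" "l < 1" using assms by linarith
  then show ?thesis
  proof cases
    case 1
    have "r \<le> exp 1 \<longleftrightarrow> ln r \<le> 1" using assms by (metis exp_le_cancel_iff exp_ln less_trans zero_less_one)
    then show ?thesis using assms 1 by (simp add: gpd_range_def gpd_kappa_def field_simps)
  next
    case 2
    then show ?thesis using assms by (simp add: gpd_range_def gpd_kappa_def)
  next
    case 3
    have rl: "1 < r powr l" using assms 3 by (simp add: gr_one_powr)
    have "r \<le> (1 - l) powr (- 1 / l) \<longleftrightarrow> r powr l \<le> ((1 - l) powr (- 1 / l)) powr l"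
    proof (cases "r \<le> (1 - l) powr (- 1 / l)")
      case True
      then show ?thesis using 3 assms by (simp add: powr_mono2)
    next
      case False
      then show ?thesis using 3 powr_less_mono2[of l "(1 - l) powr (- 1 / l)" r] by simp
    qed
    also have "((1 - l) powr (- 1 / l)) powr l = 1 / (1 - l)"
      unfolding powr_powr using 3 by (simp add: powr_minus_divide)
    also have "r powr l \<le> 1 / (1 - l) \<longleftrightarrow> (1 - l) * (r powr l - 1) \<le> l"
      using 3 by (simp add: field_simps)
    also have "\<dots> \<longleftrightarrow> (1 - l) * (r powr l - 1) * r \<le> l * r"
      using assms by simp
    also have "\<dots> \<longleftrightarrow> (1 - l) * r \<le> gpd_kappa l r"
      using 3 rl by (simp add: gpd_kappa_def pos_le_divide_eq mult_ac)
    finally show ?thesis using 3 assms by (simp add: gpd_range_def)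
  qed
qed

section \<open>Truncated generalized Pareto distributions are regular\<close>

lemma is_interval_real_sing: "is_interval {c::real}"
  using is_interval_cc[of c c] by simp

locale value_measure = prob_space F for F :: "real measure" +
  assumes sets_F [simp, measurable_cong]: "sets F = sets borel"
begin

lemma space_F [simp]: "space F = UNIV"
  using sets_eq_imp_space_eq[OF sets_F] by simp

lemma measure_atLeast: "measure F {v..} = 1 - CDF F v"
proof -
  have "UNIV - {..<v} = {v..}" by auto
  then show ?thesis using prob_compl[of "{..<v}"] by (simp add: CDF_def)
qed

lemma measure_Ico: "u \<le> v \<Longrightarrow> measure F {u..<v} = CDF F v - CDF F u"
proof -
  assume "u \<le> v"
  then have "{..<v} - {..<u} = {u..<v}" "{..<u} \<subseteq> {..<v}" by auto
  then show ?thesis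
    using finite_measure_Diff[of "{..<v}" "{..<u}"] by (simp add: CDF_def)
qed

lemma CDF_mono: "u \<le> v \<Longrightarrow> CDF F u \<le> CDF F v"
  unfolding CDF_def by (rule finite_measure_mono) auto

lemma measure_eq_0_mono: "measure F B = 0 \<Longrightarrow> A \<subseteq> B \<Longrightarrow> B \<in> sets borel \<Longrightarrow> measure F A = 0"
  using finite_measure_mono[of A B] measure_nonneg[of F A] by simp

lemma measure_greaterThan_eq_0:
  assumes "\<And>w. v < w \<Longrightarrow> measure F {w..} = 0"
  shows "measure F {v<..} = 0"
proof -
  have "emeasure F (\<Union>n. {v + inverse (real (Suc n))..}) = 0"
    by (rule emeasure_UN_eq_0) (use assms in \<open>auto simp: emeasure_eq_measure\<close>)
  moreover have "{v<..} \<subseteq> (\<Union>n. {v + inverse (real (Suc n))..})"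
  proof
    fix x assume "x \<in> {v<..}"
    then obtain n where "inverse (real (Suc n)) < x - v"
      using reals_Archimedean[of "x - v"] by auto
    then show "x \<in> (\<Union>n. {v + inverse (real (Suc n))..})" by (auto intro!: exI[of _ n])
  qed
  ultimately have "emeasure F {v<..} \<le> 0"
    using emeasure_mono[of "{v<..}" "\<Union>n. {v + inverse (real (Suc n))..}" F] by simp
  then show ?thesis by (simp add: emeasure_eq_measure)
qed

end

locale gpd_measure = value_measure F for F :: "real measure" +
  fixes l r :: real
  assumes l: "0 \<le> l" "l \<le> 1" and r: "r \<in> gpd_range l"
    and CDF_eq: "\<And>v. 0 \<le> v \<Longrightarrow> CDF F v = gpd_CDF l r v"
begin

lemma r_ge_1: "1 \<le> r" using gpd_range_ge_1[OF l r] .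

abbreviation T :: "real \<Rightarrow> real" where "T \<equiv> gpd_tail l r"
abbreviation \<kappa> :: real where "\<kappa> \<equiv> gpd_kappa l r"

lemma curve: "1 < r \<Longrightarrow> tail_curve T l \<kappa>"
  using gpd_tail_curve[OF l] .

lemma T_0: "T 0 = 1"
  using curve r_ge_1 by (cases "r = 1") (auto simp: gpd_tail_1 tail_curve_def)

lemma T_r: "T r = 1 / r"
  using gpd_tail_r[OF l(1) r_ge_1] .

lemma CDF_le_r: "0 \<le> v \<Longrightarrow> v \<le> r \<Longrightarrow> CDF F v = 1 - T v"
  by (simp add: CDF_eq gpd_CDF_eq)

lemma CDF_gt_r: "r < v \<Longrightarrow> CDF F v = 1"
  using r_ge_1 by (simp add: CDF_eq gpd_CDF_eq)

lemma measure_neg: "measure F {..<0} = 0"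
  using CDF_le_r[of 0] r_ge_1 by (simp add: CDF_def T_0)

lemma measure_Ico_T: "0 \<le> u \<Longrightarrow> u \<le> v \<Longrightarrow> v \<le> r \<Longrightarrow> measure F {u..<v} = T u - T v"
  by (simp add: measure_Ico CDF_le_r)

lemma measure_above_r: "measure F {r<..} = 0"
  by (rule measure_greaterThan_eq_0) (simp add: measure_atLeast CDF_gt_r)

lemma measure_r: "measure F {r} = 1 / r"
proof -
  have "{r..} = {r} \<union> {r<..}" by auto
  then have "measure F {r..} = measure F {r} + measure F {r<..}"
    using finite_measure_Union[of "{r}" "{r<..}"] by simp
  then show ?thesis
    using measure_atLeast[of r] CDF_le_r[of r] r_ge_1 by (simp add: measure_above_r T_r)
qed

lemma measure_point:
  assumes "v < r" shows "measure F {v} = 0"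
proof -
  consider "v < 0" | "0 \<le> v" "r = 1" | "0 \<le> v" "1 < r" using r_ge_1 by linarith
  then show ?thesis
  proof cases
    case 1
    then show ?thesis using measure_eq_0_mono[OF measure_neg, of "{v}"] by auto
  next
    case 2
    have "measure F {0..<1} = 0" using measure_Ico_T[of 0 1] 2 by (simp add: gpd_tail_1)
    then show ?thesis using measure_eq_0_mono[of "{0..<1}" "{v}"] 2 assms by auto
  next
    case 3
    interpret tail_curve T l \<kappa> using curve[OF 3(2)] .
    have "measure F {v} \<le> 0 + e" if "0 < e" for e
    proof -
      have "isCont T v" using DERIV_isCont[OF G_deriv[OF 3(1)]] .
      then obtain d where d: "0 < d" "\<And>w. \<bar>w - v\<bar> < d \<Longrightarrow> \<bar>T w - T v\<bar> < e"
        using \<open>0 < e\<close> by (auto simp: continuous_at_real_range)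
      define w where "w = min (v + d / 2) r"
      have w: "v < w" "w \<le> r" "\<bar>w - v\<bar> < d" using d(1) assms by (auto simp: w_def)
      have "measure F {v} \<le> measure F {v..<w}" using w by (intro finite_measure_mono) auto
      also have "\<dots> = T v - T w" using w 3 by (intro measure_Ico_T) auto
      also have "\<dots> \<le> e" using d(2)[OF w(3)] by linarith
      finally show ?thesis by simp
    qed
    then have "measure F {v} \<le> 0" by (rule field_le_epsilon)
    then show ?thesis by (simp add: measure_le_0_iff)
  qed
qed

text \<open>For \<open>r = 1\<close> the tail does not decrease before 1 and the measure is the
  point mass at 1; otherwise strict decrease puts mass near every point of
  \<open>{0..r}\<close>.\<close>

lemma msupp_eq: "msupp F = (if r = 1 then {1} else {0..r})"
proof -
  have in_r: "r \<in> msupp F" unfolding msupp_def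
  proof clarsimp
    fix e :: real assume "0 < e"
    then have "measure F {r} \<le> measure F {r - e<..<r + e}"
      by (intro finite_measure_mono) auto
    then show "0 < measure F {r - e<..<r + e}"
      using r_ge_1 by (simp add: measure_r less_le_trans[of 0 "1 / r"])
  qed
  have out1: "x \<notin> msupp F" if "x < 0" for x
  proof -
    have "measure F {x - (- x)<..<x + (- x)} = 0"
      by (rule measure_eq_0_mono[OF measure_neg]) auto
    then show ?thesis unfolding msupp_def using that by (auto intro!: exI[of _ "- x"])
  qed
  have out2: "x \<notin> msupp F" if "r < x" for x
  proof -
    have "measure F {x - (x - r)<..<x + (x - r)} = 0"
      by (rule measure_eq_0_mono[OF measure_above_r]) auto
    then show ?thesis unfolding msupp_def using that by (auto intro!: exI[of _ "x - r"])
  qed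
  show ?thesis
  proof (cases "r = 1")
    case True
    have mid: "x \<notin> msupp F" if "0 \<le> x" "x < 1" for x
    proof -
      have "measure F {..<1} = 0" using CDF_le_r[of 1] True by (simp add: CDF_def gpd_tail_1)
      then have "measure F {x - (1 - x)<..<x + (1 - x)} = 0"
        by (rule measure_eq_0_mono) auto
      then show ?thesis unfolding msupp_def using that by (auto intro!: exI[of _ "1 - x"])
    qed
    have "x \<in> msupp F \<longleftrightarrow> x = 1" for x
    proof -
      consider "x < 0" | "0 \<le> x" "x < 1" | "x = 1" | "r < x" using True by linarith
      then show ?thesis using out1[of x] mid[of x] out2[of x] in_r True by cases auto
    qed
    then have "msupp F = {1}" by (intro set_eqI) simp
    then show ?thesis using True by simp
  next
    case False
    then have r1: "1 < r" using r_ge_1 by simp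
    interpret tail_curve T l \<kappa> using curve[OF r1] .
    have mid: "x \<in> msupp F" if "0 \<le> x" "x < r" for x unfolding msupp_def
    proof clarsimp
      fix e :: real assume "0 < e"
      define w where "w = min (x + e) r"
      have w: "x < w" "w \<le> r" "w \<le> x + e" using \<open>0 < e\<close> that by (auto simp: w_def)
      have "0 < T x - T w" using G_strict_antimono[of x w] that w by simp
      also have "\<dots> = measure F {x..<w}" using that w by (intro measure_Ico_T[symmetric]) auto
      also have "\<dots> \<le> measure F {x - e<..<x + e}"
        using w \<open>0 < e\<close> by (intro finite_measure_mono) auto
      finally show "0 < measure F {x - e<..<x + e}" .
    qed
    have "x \<in> msupp F \<longleftrightarrow> 0 \<le> x \<and> x \<le> r" for x
    proof -
      consider "x < 0" | "0 \<le> x" "x < r" | "x = r" | "r < x" by linarith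
      then show ?thesis using out1[of x] mid[of x] out2[of x] in_r r1 by cases auto
    qed
    then have "msupp F = {0..r}" by (intro set_eqI) simp
    then show ?thesis using False by simp
  qed
qed

lemma cont_supp_eq: "cont_supp F = (if r = 1 then {} else {0..<r})"
  using measure_point measure_r r_ge_1 unfolding cont_supp_def msupp_eq
  by (auto simp: less_le)

definition dens :: "real \<Rightarrow> real" where
  "dens v = (if 0 \<le> v \<and> v < r \<and> 1 < r then T v / (l * v + \<kappa>) else 0)"

lemma has_density_dens: "has_density F dens"
proof (cases "r = 1")
  case True
  then have "dens = (\<lambda>_. 0)" unfolding dens_def by auto
  then show ?thesis using True by (auto simp: has_density_def cont_supp_eq)
next
  case False
  then have r1: "1 < r" using r_ge_1 by simp
  interpret tail_curve T l \<kappa> using curve[OF r1] .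
  let ?f = "\<lambda>v. T v / (l * v + \<kappa>)"
  have [measurable]: "T \<in> borel_measurable borel" unfolding gpd_tail_def by measurable
  have dens: "dens = (\<lambda>v. indicator {0..<r} v * ?f v)" using r1 by (auto simp: dens_def)
  have [measurable]: "dens \<in> borel_measurable borel" unfolding dens by measurable
  have dens_nonneg: "0 \<le> dens v" for v
  proof (cases "v \<in> {0..<r}")
    case True
    then show ?thesis using G_pos[of v] denom_pos[of v] by (simp add: dens)
  qed (simp add: dens)
  \<comment> \<open>Both measures describe the part of \<open>F\<close> before \<open>r\<close>, the
    second through the density. Agreement on the half-lines \<open>{x<..}\<close> suffices, and
    there it is the fundamental theorem of calculus for \<open>- T\<close>.\<close>
  define M1 where "M1 = density F (indicator {0..<r})"
  define M2 where "M2 = density lborel dens"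
  have "M1 = M2"
  proof (rule measure_eqI_lessThan)
    show "sets M1 = sets borel" "sets M2 = sets borel" by (simp_all add: M1_def M2_def)
    have M1: "emeasure M1 {x<..} = emeasure F ({0..<r} \<inter> {x<..})" for x
      unfolding M1_def by (subst emeasure_density) (auto simp flip: indicator_inter_arith
        intro!: nn_integral_indicator)
    then show "emeasure M1 {x<..} < \<infinity>" for x by (simp add: less_top[symmetric])
    show "emeasure M1 {x<..} = emeasure M2 {x<..}" for x
    proof (cases "r \<le> x")
      case True
      then have "{0..<r} \<inter> {x<..} = {}" by auto
      moreover have "emeasure M2 {x<..} = 0"
        unfolding M2_def using True by (subst emeasure_density)
          (auto simp: dens indicator_def nn_integral_0_iff_AE)
      ultimately show ?thesis by (simp add: M1)
    next
      case False
      \<comment> \<open>Half-lines that start left of 0 are cut at 0; adding the endpoint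
        \<open>y\<close> is harmless because it carries no atom.\<close>
      define y where "y = max x 0"
      have y: "0 \<le> y" "y < r" using False r1 by (auto simp: y_def)
      have "measure F ({0..<r} \<inter> {x<..}) = measure F {y..<r}"
      proof (rule antisym)
        show "measure F ({0..<r} \<inter> {x<..}) \<le> measure F {y..<r}"
          by (intro finite_measure_mono) (auto simp: y_def)
        have "measure F {y..<r} \<le> measure F (({0..<r} \<inter> {x<..}) \<union> {y})"
          by (intro finite_measure_mono) (auto simp: y_def)
        also have "\<dots> \<le> measure F ({0..<r} \<inter> {x<..}) + measure F {y}"
          by (intro measure_Un_le) auto
        finally show "measure F {y..<r} \<le> measure F ({0..<r} \<inter> {x<..})"
          using measure_point[OF y(2)] by simp
      qed
      then have "emeasure M1 {x<..} = ennreal (- T r - - T y)"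
        using measure_Ico_T[of y r] y by (simp add: M1 emeasure_eq_measure)
      also have "\<dots> = (\<integral>\<^sup>+v. ennreal (?f v) * indicator {y..r} v \<partial>lborel)"
      proof (rule nn_integral_FTC_Icc[symmetric])
        fix v assume "v \<in> {y..r}"
        then have v: "0 \<le> v" using y by simp
        show "((\<lambda>v. - T v) has_real_derivative ?f v) (at v)"
          using DERIV_minus[OF G_deriv[OF v]] by simp
        show "0 \<le> ?f v" using G_pos[OF v] denom_pos[OF v] by simp
      qed (use y in auto)
      also have "\<dots> = (\<integral>\<^sup>+v. ennreal (dens v) * indicator {x<..} v \<partial>lborel)"
      proof (rule nn_integral_cong_AE)
        have "AE v in lborel. v \<noteq> y" "AE v in lborel. v \<noteq> r" by (rule AE_lborel_singleton)+
        then show "AE v in lborel. ennreal (?f v) * indicator {y..r} v = ennreal (dens v) * indicator {x<..} v"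
          by eventually_elim (use y r1 in \<open>auto simp: dens indicator_def y_def max_def split: if_splits\<close>)
      qed
      also have "\<dots> = emeasure M2 {x<..}"
        unfolding M2_def by (subst emeasure_density) auto
      finally show ?thesis .
    qed
  qed
  then have "emeasure F A = (\<integral>\<^sup>+v\<in>A. ennreal (dens v) \<partial>lborel)"
    if "A \<in> sets borel" "A \<subseteq> {0..<r}" for A
  proof -
    have "emeasure F A = emeasure F ({0..<r} \<inter> A)" using that(2) by (simp add: Int_absorb1)
    also have "\<dots> = emeasure M1 A"
      unfolding M1_def using that by (subst emeasure_density) (auto simp flip: indicator_inter_arith
        intro!: nn_integral_indicator[symmetric])
    also have "\<dots> = emeasure M2 A" using \<open>M1 = M2\<close> by simp
    also have "\<dots> = (\<integral>\<^sup>+v\<in>A. ennreal (dens v) \<partial>lborel)"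
      unfolding M2_def using that by (subst emeasure_density) auto
    finally show ?thesis .
  qed
  then show ?thesis using False dens_nonneg by (auto simp: has_density_def cont_supp_eq)
qed

text \<open>The range condition keeps the revenue peak from lying before \<open>r\<close>, so the
  revenue grows up to \<open>r\<close>, where it is 1; above \<open>r\<close> nothing is
  sold.\<close>

lemma monopoly_reserve_r: "monopoly_reserve F r"
  unfolding monopoly_reserve_def
proof (intro conjI allI impI)
  show "r \<in> msupp F" using r_ge_1 by (simp add: msupp_eq)
  fix q :: real assume q: "0 \<le> q"
  have rev_r: "r * (1 - CDF F r) = 1" using r_ge_1 by (simp add: CDF_le_r T_r)
  consider "r < q" | "q \<le> r" "r = 1" | "q \<le> r" "1 < r" using r_ge_1 by linarith
  then show "q * (1 - CDF F q) \<le> r * (1 - CDF F r)"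
  proof cases
    case 3
    interpret tail_curve T l \<kappa> using curve[OF 3(2)] .
    have "(1 - l) * r \<le> \<kappa>" using gpd_range_iff[OF l 3(2)] r by simp
    from revenue_mono[OF this q 3(1)] show ?thesis
      using q 3 by (simp add: CDF_le_r)
  qed (use rev_r q in \<open>auto simp: CDF_gt_r CDF_le_r gpd_tail_1\<close>)
qed

lemma regular: "F \<in> regular_class l"
proof -
  have "valuation_distribution F"
    unfolding valuation_distribution_def
  proof (intro conjI allI impI ballI)
    show "prob_space F" by unfold_locales
    show "is_interval (msupp F)" by (simp add: msupp_eq is_interval_cc is_interval_real_sing)
    show "\<exists>f. has_density F f" using has_density_dens by blast
    show "\<exists>p. monopoly_reserve F p" using monopoly_reserve_r by blast
    fix v w assume "0 < measure F {v}" "w \<in> msupp F"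
    then show "w \<le> v" using measure_point[of v] r_ge_1 by (cases "v < r") (auto simp: msupp_eq split: if_splits)
  qed (simp_all add: measure_neg)
  moreover have "lambda_regular l F"
    unfolding lambda_regular_def
  proof (intro exI conjI)
    show "has_density F dens" by (rule has_density_dens)
    have "ereal (l * v) - ereal (1 - CDF F v) / ereal (dens v) = ereal (- \<kappa>)"
      if "v \<in> cont_supp F" for v
    proof -
      have v: "0 \<le> v" "v < r" "1 < r" using that r_ge_1 by (auto simp: cont_supp_eq split: if_splits)
      interpret tail_curve T l \<kappa> using curve[OF v(3)] .
      show ?thesis using v G_pos[of v] denom_pos[of v]
        by (simp add: CDF_le_r dens_def field_simps)
    qed
    then show "mono_on (cont_supp F) (\<lambda>v. ereal (l * v) - ereal (1 - CDF F v) / ereal (dens v))"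
      by (auto intro!: mono_onI)
  qed
  ultimately show ?thesis by (simp add: regular_class_def)
qed

end

lemma gpd_measureI:
  assumes "0 \<le> l" "l \<le> 1" "F \<in> gpd_class l"
  obtains r where "gpd_measure F l r"
proof -
  from assms(3) obtain r where r: "r \<in> gpd_range l" "\<And>v. 0 \<le> v \<Longrightarrow> CDF F v = gpd_CDF l r v"
    "prob_space F" "sets F = sets borel" by (auto simp: gpd_class_def)
  interpret prob_space F by fact
  have "gpd_measure F l r" using assms r by unfold_locales auto
  then show ?thesis by (rule that)
qed

text \<open>The witness for strictness of the inclusion. Its continuous part is empty, so regularity
  is vacuous, while every Pareto member sells at \<open>r\<close> with probability
  \<open>1 / r > 0\<close>.\<close>

lemma return_0_regular:
  assumes "0 \<le> l"
  shows "return borel (0::real) \<in> regular_class l"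
proof -
  let ?F = "return borel (0::real)"
  have meas: "measure ?F A = indicator A 0" if "A \<in> sets borel" for A
    using that by (rule measure_return)
  have supp: "msupp ?F = {0}"
  proof -
    have "x \<notin> msupp ?F" if "x \<noteq> 0" for x
      unfolding msupp_def using that by (auto simp: meas intro!: exI[of _ "\<bar>x\<bar>"])
    moreover have "0 \<in> msupp ?F" by (auto simp: msupp_def meas)
    ultimately show ?thesis by auto
  qed
  have cont: "cont_supp ?F = {}" by (auto simp: cont_supp_def supp meas)
  have dens: "has_density ?F (\<lambda>_. 0)" by (auto simp: has_density_def cont)
  have "monopoly_reserve ?F 0"
    by (auto simp: monopoly_reserve_def supp CDF_def meas indicator_def)
  then have "valuation_distribution ?F"
    unfolding valuation_distribution_def
    using dens by (auto simp: supp meas indicator_def prob_space_return is_interval_real_sing split: if_splits)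
  moreover have "lambda_regular l ?F"
    unfolding lambda_regular_def using dens by (auto simp: cont)
  ultimately show ?thesis by (simp add: regular_class_def)
qed

lemma return_0_not_gpd:
  assumes "0 \<le> l" "l \<le> 1"
  shows "return borel (0::real) \<notin> gpd_class l"
proof
  assume "return borel (0::real) \<in> gpd_class l"
  then obtain r where "gpd_measure (return borel 0) l r" using gpd_measureI[OF assms] by blast
  then interpret gpd_measure "return borel 0" l r .
  have "CDF (return borel 0) r = 1" using r_ge_1 by (simp add: CDF_def measure_return)
  then show False using CDF_le_r[of r] r_ge_1 by (simp add: T_r)
qed

lemma gpd_class_psubset:
  assumes "0 \<le> l" "l \<le> 1"
  shows "gpd_class l \<subset> regular_class l"
proof -
  have "gpd_class l \<subseteq> regular_class l"
    using gpd_measureI[OF assms] gpd_measure.regular by blast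
  then show ?thesis using return_0_regular[OF assms(1)] return_0_not_gpd[OF assms] by blast
qed

section \<open>Coupling a regular distribution with a Pareto distribution\<close>

context value_measure
begin

text \<open>The complement of the support is the union of all open null sets, hence open; by
  Lindelof countably many of them suffice, hence it is null.\<close>

lemma closed_msupp: "closed (msupp F)"
  and measure_outside_msupp: "measure F (- msupp F) = 0"
proof -
  define \<U> where "\<U> = {U. open U \<and> measure F U = 0}"
  have eq: "- msupp F = \<Union>\<U>"
  proof (rule set_eqI, rule iffI)
    fix x assume "x \<in> - msupp F"
    then obtain e where "0 < e" "\<not> 0 < measure F {x - e<..<x + e}" by (auto simp: msupp_def)
    then have "{x - e<..<x + e} \<in> \<U>" "x \<in> {x - e<..<x + e}"
      by (auto simp: \<U>_def less_le)
    then show "x \<in> \<Union>\<U>" by (rule UnionI)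
  next
    fix x assume "x \<in> \<Union>\<U>"
    then obtain U where U: "open U" "measure F U = 0" "x \<in> U" by (auto simp: \<U>_def)
    obtain e where e: "0 < e" "ball x e \<subseteq> U" using openE[OF U(1,3)] by blast
    have "{x - e<..<x + e} \<subseteq> U" using e(2) by (simp add: ball_eq_greaterThanLessThan)
    then have "measure F {x - e<..<x + e} = 0"
      using measure_eq_0_mono[OF U(2)] U(1) by simp
    then show "x \<in> - msupp F" using e(1) by (auto simp: msupp_def intro!: exI[of _ e])
  qed
  have "open (- msupp F)" unfolding eq by (rule open_Union) (auto simp: \<U>_def)
  then show "closed (msupp F)" by (simp add: closed_def)
  obtain \<V> where \<V>: "\<V> \<subseteq> \<U>" "countable \<V>" "\<Union>\<V> = \<Union>\<U>"
    using Lindelof[of \<U>] by (auto simp: \<U>_def)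
  have "(\<Union>U\<in>\<V>. U) \<in> null_sets F"
    using \<V>(1) by (intro null_sets_UN' \<V>(2)) (auto simp: \<U>_def null_sets_def emeasure_eq_measure)
  then show "measure F (- msupp F) = 0"
    using \<V>(3) by (simp add: eq null_sets_def measure_def)
qed

lemma msupp_borel [measurable]: "msupp F \<in> sets borel"
  using closed_msupp by simp

lemma emeasure_Int_msupp:
  assumes "A \<in> sets borel"
  shows "emeasure F (A \<inter> msupp F) = emeasure F A"
proof -
  have "- msupp F \<in> null_sets F"
    using measure_outside_msupp by (auto simp: null_sets_def emeasure_eq_measure)
  moreover have "A - (- msupp F) = A \<inter> msupp F" by auto
  ultimately show ?thesis using emeasure_Diff_null_set[of "- msupp F" F A] assms by simp
qed

end

lemma nn_integral_const_Ico:
  fixes h u w :: real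
  assumes "0 \<le> h" "u \<le> w"
  shows "(\<integral>\<^sup>+x. ennreal h * indicator {u..<w} x \<partial>lborel) = ennreal (h * (w - u))"
  using assms by (subst nn_integral_cmult_indicator) (auto simp: ennreal_mult)

text \<open>Where the density \<open>y\<close> vanishes, \<open>s / 0\<close> is infinite in
  \<open>ereal\<close> and the virtual value is \<open>-\<infinity>\<close>; so the translation into
  hazard bounds needs no positive density.\<close>

lemma virtual_value_le_iff:
  fixes s y a k :: real
  assumes "0 < s" "0 \<le> y" "0 < a + k"
  shows "ereal a - ereal s / ereal y \<le> ereal (- k) \<longleftrightarrow> y \<le> s / (a + k)"
    and "ereal (- k) \<le> ereal a - ereal s / ereal y \<longleftrightarrow> s / (a + k) \<le> y"
proof -
  have *: "ereal a - ereal s / ereal y \<le> ereal (- k) \<longleftrightarrow> y \<le> s / (a + k)"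
    "ereal (- k) \<le> ereal a - ereal s / ereal y \<longleftrightarrow> s / (a + k) \<le> y"
    if "0 < y" using that assms by (simp_all add: field_simps)
  have **: "ereal s / ereal y = \<infinity>" if "y = 0" using that assms by simp
  show "ereal a - ereal s / ereal y \<le> ereal (- k) \<longleftrightarrow> y \<le> s / (a + k)"
    using * ** assms by (cases "y = 0") (auto simp: not_le less_imp_le)
  show "ereal (- k) \<le> ereal a - ereal s / ereal y \<longleftrightarrow> s / (a + k) \<le> y"
  proof (cases "y = 0")
    case True
    have "0 < s / (a + k)" using assms by simp
    with True ** show ?thesis by simp
  qed (use * assms in auto)
qed

section \<open>Domination of the Pareto tail by a regular tail\<close>

context tail_curve
begin

lemma scaled: "0 < c \<Longrightarrow> tail_curve (\<lambda>v. G (v * c)) l (\<kappa> / c)"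
proof unfold_locales
  fix v :: real assume c: "0 < c" and v: "0 \<le> v"
  have "((\<lambda>v. G (v * c)) has_real_derivative - G (v * c) / (l * (v * c) + \<kappa>) * c) (at v)"
    using c v by (intro DERIV_chain2[OF G_deriv]) (auto intro!: derivative_eq_intros)
  also have "- G (v * c) / (l * (v * c) + \<kappa>) * c = - G (v * c) / (l * v + \<kappa> / c)"
  proof -
    have "l * v + \<kappa> / c = (l * (v * c) + \<kappa>) / c" using c by (simp add: field_simps)
    then show ?thesis by simp
  qed
  finally show "((\<lambda>v. G (v * c)) has_real_derivative - G (v * c) / (l * v + \<kappa> / c)) (at v)" .
qed (use G_0 G_pos l \<kappa> in auto)

text \<open>The virtual value of \<open>G\<close> is the constant \<open>- \<kappa>\<close>, so a non-decreasing virtual value crosses it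
  at most once: the ratio of the tails first increases and then decreases between two points
  where it equals 1.\<close>

lemma regular_tail_ge:
  assumes "value_measure F" and neg: "measure F {..<0} = 0"
    and interval: "is_interval (msupp F)"
    and atom: "\<And>x. x < p \<Longrightarrow> measure F {x} = 0"
    and dens: "has_density F f"
    and mono: "mono_on (cont_supp F) (\<lambda>x. ereal (l * x) - ereal (1 - CDF F x) / ereal (f x))"
    and p: "p \<in> msupp F" "G p = 1 - CDF F p"
    and v: "0 \<le> v" "v \<le> p"
  shows "G v \<le> 1 - CDF F v"
proof (rule ccontr)
  assume "\<not> G v \<le> 1 - CDF F v"
  then have less: "1 - CDF F v < G v" by simp
  interpret value_measure F by fact
  define S where "S x = 1 - CDF F x" for x
  define \<phi> where "\<phi> x = ereal (l * x) - ereal (S x) / ereal (f x)" for x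
  have \<phi>_mono: "\<phi> x \<le> \<phi> y" if "x \<in> cont_supp F" "y \<in> cont_supp F" "x \<le> y" for x y
    unfolding \<phi>_def S_def by (rule mono_onD[OF mono that])
  have S_antimono: "x \<le> y \<Longrightarrow> S y \<le> S x" for x y
    using CDF_mono[of x y] by (simp add: S_def)
  have S01: "0 \<le> S x \<and> S x \<le> 1" for x by (simp add: S_def CDF_def)
  have S0: "S 0 = 1" using neg by (simp add: S_def CDF_def)
  have S_diff: "S x - S y = measure F {x..<y}" if "x \<le> y" for x y
    using measure_Ico[OF that] by (simp add: S_def)
  have "v \<noteq> p" using less p(2) by auto
  then have "v < p" using v by simp
  have S_pos: "0 < S x" if "x \<le> p" for x
    using S_antimono[OF that] G_pos[of p] p(2) v by (simp add: S_def)
  have f0: "0 \<le> f x" for x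
    using dens by (simp add: has_density_def)
  have f: "emeasure F A = (\<integral>\<^sup>+x\<in>A. ennreal (f x) \<partial>lborel)"
    if "A \<in> sets borel" "A \<subseteq> cont_supp F" for A
    using dens that by (simp add: has_density_def)
  have cont: "x \<in> cont_supp F" if "x \<in> msupp F" "x < p" for x
    using that atom[of x] by (simp add: cont_supp_def)
  \<comment> \<open>The strict inequality forces mass below \<open>v\<close>, so the support has a
    point left of \<open>v\<close>; it also contains \<open>p\<close> and is an interval.\<close>
  have "v \<in> msupp F"
  proof -
    have "measure F {..<v} \<noteq> 0" using less G_le_1[OF v(1)] by (auto simp: CDF_def)
    then have "\<not> {..<v} \<subseteq> - msupp F"
      using measure_eq_0_mono[OF measure_outside_msupp] by auto
    then obtain a where "a < v" "a \<in> msupp F" by auto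
    then show ?thesis using interval p(1) v(2) unfolding is_interval_1 by (meson less_imp_le)
  qed
  have pos: "0 < l * x + \<kappa>" if "0 \<le> x" for x using denom_pos[OF that] .
  have hazard_antimono: "S y / (l * y + \<kappa>) \<le> S x / (l * x + \<kappa>)" if "0 \<le> x" "x \<le> y" for x y
    using that l S01 S_antimono pos by (intro frac_le) (auto intro: mult_left_mono)
  show False
  \<comment> \<open>If the virtual value at \<open>v\<close> is at most the constant of
    \<open>G\<close>, so it is before \<open>v\<close>: the hazard rate of \<open>F\<close> is the
    smaller one there and \<open>S / G\<close> rises from 1 at 0. Otherwise \<open>S / G\<close>
    falls from \<open>v\<close> on and ends at 1 in \<open>p\<close>. Either way
    \<open>S v / G v\<close> is at least 1.\<close>
  proof (cases "\<phi> v \<le> ereal (- \<kappa>)")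
    case True
    have "S 0 / G 0 \<le> S v / G v"
    proof (rule ratio_mono)
      fix u w assume uw: "0 \<le> u" "u < w" "w \<le> v"
      let ?A = "{u..<w} \<inter> msupp F" and ?h = "S u / (l * u + \<kappa>)"
      have A: "?A \<subseteq> cont_supp F" using cont uw \<open>v < p\<close> by auto
      have h: "0 \<le> ?h" using S01[of u] pos[of u] uw by simp
      have "f x \<le> ?h" if "x \<in> ?A" for x
      proof -
        have x: "0 \<le> x" "u \<le> x" "x \<le> v" "x \<le> p" using that uw \<open>v < p\<close> by auto
        have "\<phi> x \<le> \<phi> v"
          using A that x cont[OF \<open>v \<in> msupp F\<close> \<open>v < p\<close>] by (intro \<phi>_mono) auto
        then have "\<phi> x \<le> ereal (- \<kappa>)" using True by (rule order_trans)
        then have "f x \<le> S x / (l * x + \<kappa>)"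
          unfolding \<phi>_def virtual_value_le_iff(1)[OF S_pos[OF x(4)] f0 pos[OF x(1)]] .
        also have "\<dots> \<le> ?h" using hazard_antimono uw(1) x(2) .
        finally show ?thesis .
      qed
      then have "emeasure F ?A \<le> (\<integral>\<^sup>+x. ennreal ?h * indicator {u..<w} x \<partial>lborel)"
        by (subst f[OF _ A]) (auto intro!: nn_integral_mono ennreal_leI split: split_indicator)
      also have "\<dots> = ennreal (?h * (w - u))"
        using uw by (intro nn_integral_const_Ico h) simp
      finally have "measure F {u..<w} \<le> ?h * (w - u)"
        using uw mult_nonneg_nonneg[OF h, of "w - u"] emeasure_Int_msupp[of "{u..<w}"]
        by (simp add: emeasure_eq_measure del: times_divide_eq_left)
      then show "S u - S w \<le> (w - u) * ?h"
        using S_diff[of u w] uw by (simp add: mult.commute)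
    qed (use v S01 in auto)
    then have "1 \<le> S v / G v" using S0 G_0 by simp
    then show False using less G_pos[OF v(1)] by (simp add: S_def field_simps)
  next
    case False
    \<comment> \<open>Between \<open>v\<close> and \<open>p\<close> everything lies in the support,
      so the density describes \<open>F\<close> on whole intervals.\<close>
    have "S p / G p \<le> S v / G v"
    proof (rule ratio_antimono)
      fix u w assume uw: "v \<le> u" "u < w" "w \<le> p"
      let ?A = "{u..<w}" and ?h = "S w / (l * w + \<kappa>)"
      have "x \<in> msupp F" if "v \<le> x" "x \<le> p" for x
        using that interval p(1) \<open>v \<in> msupp F\<close> unfolding is_interval_1 by blast
      then have A: "?A \<subseteq> cont_supp F" using cont uw by auto
      have h: "0 \<le> ?h" using S01[of w] pos[of w] uw v by simp
      have "?h \<le> f x" if "x \<in> ?A" for x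
      proof -
        have x: "0 \<le> x" "v \<le> x" "x \<le> w" "x \<le> p" using that uw v by auto
        have "\<phi> v \<le> \<phi> x"
          using A that x cont[OF \<open>v \<in> msupp F\<close> \<open>v < p\<close>] by (intro \<phi>_mono) auto
        then have "ereal (- \<kappa>) \<le> \<phi> x" using False by (auto simp: not_le intro: less_imp_le order_trans)
        then have "S x / (l * x + \<kappa>) \<le> f x"
          unfolding \<phi>_def virtual_value_le_iff(2)[OF S_pos[OF x(4)] f0 pos[OF x(1)]] .
        moreover have "?h \<le> S x / (l * x + \<kappa>)" using hazard_antimono x(1,3) .
        ultimately show ?thesis by simp
      qed
      then have "(\<integral>\<^sup>+x. ennreal ?h * indicator ?A x \<partial>lborel) \<le> emeasure F ?A"
        by (subst f[OF _ A]) (auto intro!: nn_integral_mono ennreal_leI split: split_indicator)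
      moreover have "(\<integral>\<^sup>+x. ennreal ?h * indicator ?A x \<partial>lborel) = ennreal (?h * (w - u))"
        using uw by (intro nn_integral_const_Ico h) simp
      ultimately have "?h * (w - u) \<le> measure F ?A"
        by (simp add: emeasure_eq_measure del: times_divide_eq_left)
      then show "(w - u) * ?h \<le> S u - S w"
        using S_diff[of u w] uw by (simp add: mult.commute)
    qed (use v S01 in auto)
    moreover have "S p / G p = 1" using p(2) S_pos[of p] by (simp add: S_def)
    ultimately have "1 \<le> S v / G v" by simp
    then show False using less G_pos[OF v(1)] by (simp add: S_def field_simps)
  qed
qed

end

lemma one_in_gpd_range:
  assumes "0 \<le> l" "l \<le> 1"
  shows "1 \<in> gpd_range l"
proof -
  have "1 \<le> (1 - l) powr (- 1 / l)" if "0 < l" "l < 1"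
  proof -
    have "(1 - l) powr (1 / l) \<le> 1" using that by (intro powr_le1) auto
    moreover have "0 < (1 - l) powr (1 / l)" using that by simp
    ultimately show ?thesis using that by (simp add: powr_minus_divide)
  qed
  then show ?thesis using assms by (auto simp: gpd_range_def)
qed

lemma valuation_value_measure: "valuation_distribution F \<Longrightarrow> value_measure F"
  by (simp add: valuation_distribution_def value_measure_def value_measure_axioms_def)

section \<open>Quantile transform of a valuation distribution\<close>

context value_measure
begin

lemma AE_nonneg: "measure F {..<0} = 0 \<Longrightarrow> AE x in F. 0 \<le> x"
  by (rule AE_I[of _ _ "{..<0}"]) (auto simp: emeasure_eq_measure)

text \<open>An atom at \<open>p\<close> does no harm: the strict inequality in \<open>CDF\<close>
  makes it left-continuous, and the interval ends at \<open>p\<close>.\<close>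

lemma continuous_on_CDF:
  assumes "a < p" and atom: "\<And>x. x < p \<Longrightarrow> measure F {x} = 0"
  shows "continuous_on {a..p} (CDF F)"
proof -
  interpret real_distribution F by unfold_locales auto
  have eq: "CDF F x = cdf F x" if "x < p" for x
  proof -
    have "{..x} = {..<x} \<union> {x}" by auto
    then show ?thesis
      using finite_measure_Union[of "{..<x}" "{x}"] atom[OF that] by (simp add: CDF_def cdf_def)
  qed
  have "(CDF F \<longlongrightarrow> CDF F x) (at x within {a..p})" if x: "x \<in> {a..p}" for x
  proof (cases "x = p")
    case True
    have "(cdf F \<longlongrightarrow> CDF F p) (at_left p)" unfolding CDF_def by (rule cdf_at_left)
    moreover have "\<forall>\<^sub>F y in at_left p. cdf F y = CDF F y"
      using eq by (simp add: eventually_at_filter)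
    ultimately have "(CDF F \<longlongrightarrow> CDF F p) (at_left p)" by (rule Lim_transform_eventually)
    then show ?thesis using True at_within_Icc_at_left[OF assms(1)] by simp
  next
    case False
    then have xp: "x < p" using x by simp
    have "isCont (cdf F) x" using isCont_cdf atom[OF xp] by blast
    then have "(cdf F \<longlongrightarrow> CDF F x) (at x)" using eq[OF xp] by (simp add: isCont_def)
    moreover have "\<forall>\<^sub>F y in at x. cdf F y = CDF F y"
      using order_tendstoD(2)[OF tendsto_ident_at xp] by eventually_elim (simp add: eq)
    ultimately have "(CDF F \<longlongrightarrow> CDF F x) (at x)" by (rule Lim_transform_eventually)
    then show ?thesis by (rule tendsto_within_subset) simp
  qed
  then show ?thesis by (simp add: continuous_on_def)
qed

text \<open>For \<open>s < 1\<close> the set is the half-line from the least point where the tail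
  equals \<open>s\<close>; continuity yields such a point and compactness a least one. Levels below
  the tail at \<open>p\<close> are excluded since an atom at \<open>p\<close> may skip them.\<close>

lemma measure_tail_le:
  assumes neg: "measure F {..<0} = 0" and "0 < p" and atom: "\<And>x. x < p \<Longrightarrow> measure F {x} = 0"
    and s: "1 - CDF F p \<le> s" "s \<le> 1"
  shows "measure F {x. 1 - CDF F x \<le> s} = s"
proof (cases "s = 1")
  case True
  have "{x. 1 - CDF F x \<le> 1} = UNIV" by (simp add: CDF_def)
  then show ?thesis using True prob_space by simp
next
  case False
  let ?S = "\<lambda>x. 1 - CDF F x"
  have cont: "continuous_on {0..p} ?S"
    by (intro continuous_intros continuous_on_CDF assms)
  have S0: "?S x = 1" if "x \<le> 0" for x
    using CDF_mono[OF that] neg by (simp add: CDF_def measure_le_0_iff)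
  obtain t0 where t0: "0 \<le> t0" "t0 \<le> p" "?S t0 = s"
    using IVT2'[of ?S p s 0] cont s S0[of 0] \<open>0 < p\<close> by auto
  define K where "K = {0..p} \<inter> ?S -` {..s}"
  have "closed K" unfolding K_def
    by (rule continuous_closed_preimage[OF cont]) auto
  then have "compact K" by (auto simp: K_def compact_eq_bounded_closed intro: bounded_subset[of "{0..p}"])
  moreover have "t0 \<in> K" using t0 by (simp add: K_def)
  ultimately obtain t where t: "t \<in> K" "\<And>x. x \<in> K \<Longrightarrow> t \<le> x"
    using compact_attains_inf[of K] by auto
  have "?S t = s"
    using t(1) t(2)[OF \<open>t0 \<in> K\<close>] t0(3) CDF_mono[of t t0] by (simp add: K_def)
  have "{x. ?S x \<le> s} = {t..}"
  proof (rule set_eqI)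
    fix x
    have "t \<le> x" if "?S x \<le> s"
    proof -
      have "0 \<le> x" using S0[of x] that False s(2) by (cases "x \<le> 0") auto
      then show ?thesis using that t(2)[of x] t(1) by (cases "x \<le> p") (auto simp: K_def)
    qed
    moreover have "?S x \<le> s" if "t \<le> x" using CDF_mono[OF that] \<open>?S t = s\<close> by simp
    ultimately show "x \<in> {x. ?S x \<le> s} \<longleftrightarrow> x \<in> {t..}" by auto
  qed
  then show ?thesis using measure_atLeast[of t] \<open>?S t = s\<close> by simp
qed

lemma distr_gpd:
  assumes "0 \<le> l" "l \<le> 1" and r: "r \<in> gpd_range l" and T: "T \<in> borel_measurable borel"
    and T_le: "\<And>x. T x \<le> r"
    and tail: "\<And>v. 0 \<le> v \<Longrightarrow> v \<le> r \<Longrightarrow> measure F {x. v \<le> T x} = gpd_tail l r v"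
  shows "distr F borel T \<in> gpd_class l" "monopoly_reserve (distr F borel T) r"
proof -
  let ?H = "distr F borel T"
  have T': "T \<in> measurable F borel" using T measurable_cong_sets[OF sets_F refl] by blast
  interpret H: prob_space ?H by (rule prob_space_distr[OF T'])
  have CDF: "CDF ?H v = gpd_CDF l r v" if "0 \<le> v" for v
  proof -
    have CDF_H: "CDF ?H v = measure F {x. T x < v}"
      unfolding CDF_def using measure_distr[OF T', of "{..<v}"] by (simp add: vimage_def)
    show ?thesis
    proof (cases "v \<le> r")
      case True
      have "{x. v \<le> T x} \<in> sets F"
        using measurable_sets[OF T', of "{v..}"] by (simp add: vimage_def)
      then have "measure F (UNIV - {x. v \<le> T x}) = 1 - measure F {x. v \<le> T x}"
        using prob_compl by simp
      moreover have "UNIV - {x. v \<le> T x} = {x. T x < v}" by auto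
      ultimately show ?thesis using CDF_H tail[OF that True] True by (simp add: gpd_CDF_eq)
    next
      case False
      then have "T x < v" for x using le_less_trans[OF T_le, of v x] by simp
      then have "{x. T x < v} = UNIV" by simp
      then show ?thesis using CDF_H False prob_space by (simp add: gpd_CDF_eq)
    qed
  qed
  show "?H \<in> gpd_class l"
    using H.prob_space_axioms r CDF by (auto simp: gpd_class_def)
  interpret gpd_measure ?H l r
    using assms(1,2) r CDF by unfold_locales auto
  show "monopoly_reserve ?H r" by (rule monopoly_reserve_r)
qed

end

text \<open>The generalized Pareto distribution is obtained as the image of \<open>F\<close> under a map that lies
  below the rescaling \<open>x \<mapsto> r / p * x\<close> and sends values above the reserve \<open>p\<close> to \<open>r\<close>.\<close>

lemma regular_coupling:
  assumes l: "0 \<le> l" "l \<le> 1" and F: "F \<in> regular_class l"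
    and reserve: "monopoly_reserve F p" and "0 < p" "CDF F p < 1"
  obtains T r where "0 < r" "T \<in> borel_measurable borel"
    "distr F borel T \<in> gpd_class l" "monopoly_reserve (distr F borel T) r"
    "AE x in F. T x \<le> r / p * x" "\<And>x. 0 \<le> T x" "\<And>x. T x \<le> r" "\<And>x. p \<le> x \<Longrightarrow> T x = r"
proof -
  have val: "valuation_distribution F" and reg: "lambda_regular l F"
    using F by (auto simp: regular_class_def)
  interpret value_measure F using valuation_value_measure[OF val] .
  have neg: "measure F {..<0} = 0" and interval: "is_interval (msupp F)"
    using val by (auto simp: valuation_distribution_def)
  have p: "p \<in> msupp F" and p_max: "\<And>q. 0 \<le> q \<Longrightarrow> q * (1 - CDF F q) \<le> p * (1 - CDF F p)"
    using reserve by (auto simp: monopoly_reserve_def)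
  have atom: "measure F {x} = 0" if "x < p" for x
  proof (rule ccontr)
    assume "measure F {x} \<noteq> 0"
    then have "0 < measure F {x}" by (simp add: less_le)
    then have "p \<le> x" using val p by (auto simp: valuation_distribution_def)
    then show False using that by simp
  qed
  define S where "S x = 1 - CDF F x" for x
  have S_antimono: "x \<le> y \<Longrightarrow> S y \<le> S x" for x y
    using CDF_mono[of x y] by (simp add: S_def)
  have S01: "0 \<le> S x" "S x \<le> 1" for x by (simp_all add: S_def CDF_def)
  have Sp: "0 < S p" using \<open>CDF F p < 1\<close> by (simp add: S_def)
  \<comment> \<open>Chosen so that the Pareto tail at its own reserve, which is
    \<open>1 / r\<close>, equals the sale probability of \<open>F\<close> at
    \<open>p\<close>.\<close>
  define r where "r = 1 / S p"
  have r1: "1 \<le> r" using S01[of p] Sp by (simp add: r_def)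
  have Sp_r: "S p = 1 / r" by (simp add: r_def)
  show ?thesis
  proof (cases "r = 1")
    \<comment> \<open>\<open>F\<close> sells at \<open>p\<close> with certainty and the Pareto
      member is the point mass at 1, so the map is written down directly.\<close>
    case True
    define T :: "real \<Rightarrow> real" where "T x = (if p \<le> x then 1 else 0)" for x
    have T_meas: "T \<in> borel_measurable borel" unfolding T_def by measurable
    have below: "measure F {..<p} = 0" using True Sp_r by (simp add: S_def CDF_def)
    have tail: "measure F {x. v \<le> T x} = gpd_tail l 1 v" if "0 \<le> v" "v \<le> 1" for v
    proof -
      have "measure F {p..} \<le> measure F {x. v \<le> T x}"
        using that T_meas by (intro finite_measure_mono) (auto simp: T_def)
      moreover have "measure F {p..} = 1" using below measure_atLeast[of p] by (simp add: CDF_def)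
      ultimately show ?thesis using prob_le_1[of "{x. v \<le> T x}"] by (simp add: gpd_tail_1)
    qed
    have "AE x in F. p \<le> x"
      by (rule AE_I[of _ _ "{..<p}"]) (auto simp: emeasure_eq_measure below)
    then have "AE x in F. T x \<le> 1 / p * x"
    proof eventually_elim
      case (elim x)
      then show ?case using \<open>0 < p\<close> by (simp add: T_def)
    qed
    moreover have "distr F borel T \<in> gpd_class l" "monopoly_reserve (distr F borel T) 1"
      by (rule distr_gpd[OF l one_in_gpd_range[OF l] T_meas _ tail]; simp add: T_def)+
    ultimately show ?thesis
      using T_meas by (intro that[of 1 T]) (simp_all add: T_def)
  next
    case False
    then have r: "1 < r" using r1 by simp
    let ?G = "gpd_tail l r" and ?\<kappa> = "gpd_kappa l r"
    interpret tail_curve ?G l ?\<kappa> using gpd_tail_curve[OF l r] .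
    have G_r: "?G r = 1 / r" using gpd_tail_r[OF l(1) r1] .
    obtain f where f: "has_density F f"
      "mono_on (cont_supp F) (\<lambda>x. ereal (l * x) - ereal (1 - CDF F x) / ereal (f x))"
      using reg by (auto simp: lambda_regular_def)
    have G_le: "?G (v * (r / p)) \<le> S v" if "0 \<le> v" "v \<le> p" for v
    proof -
      interpret sc: tail_curve "\<lambda>v. ?G (v * (r / p))" l "?\<kappa> / (r / p)"
        using r \<open>0 < p\<close> by (intro scaled) simp
      show ?thesis unfolding S_def
      proof (rule sc.regular_tail_ge[OF value_measure_axioms neg interval atom f p _ that])
        show "?G (p * (r / p)) = 1 - CDF F p" using \<open>0 < p\<close> G_r Sp_r by (simp add: S_def)
      qed
    qed
    \<comment> \<open>Otherwise some \<open>v < r\<close> has Pareto revenue above 1; by domination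
      the price \<open>w = v * (p / r)\<close> would earn more under \<open>F\<close> than
      \<open>p\<close> does.\<close>
    have range: "r \<in> gpd_range l"
    proof (rule ccontr)
      assume "r \<notin> gpd_range l"
      then have "?\<kappa> < (1 - l) * r" using gpd_range_iff[OF l r] by simp
      from revenue_not_max[OF this] r obtain v where v: "0 < v" "v < r" "1 < v * ?G v"
        using G_r by auto
      define w where "w = v * (p / r)"
      have w: "0 \<le> w" "w \<le> p" "w * (r / p) = v"
        using v r \<open>0 < p\<close> by (auto simp: w_def field_simps)
      have "v * ?G v \<le> w * (r / p) * S w"
        using G_le[OF w(1,2)] v w(3) by simp
      also have "\<dots> = (r / p) * (w * S w)" by simp
      also have "\<dots> \<le> (r / p) * (p * S p)"
        using p_max[OF w(1)] r \<open>0 < p\<close> by (intro mult_left_mono) (auto simp: S_def)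
      also have "\<dots> = 1" using r \<open>0 < p\<close> Sp_r by simp
      finally show False using v(3) by simp
    qed
    have "\<exists>y. 0 \<le> y \<and> y \<le> r \<and> ?G y = s" if "1 / r \<le> s" "s \<le> 1" for s
      using IVT2'[of ?G r s 0] that G_r G_0 r continuous_on_G[of "{0..r}"] by auto
    then obtain Gi where Gi: "\<And>s. 1 / r \<le> s \<Longrightarrow> s \<le> 1 \<Longrightarrow> 0 \<le> Gi s \<and> Gi s \<le> r \<and> ?G (Gi s) = s"
      by metis
    \<comment> \<open>The quantile transform below \<open>p\<close>: \<open>T x\<close> is the
      Pareto value with the same tail probability as \<open>x\<close>. Everything from
      \<open>p\<close> on goes to the atom \<open>r\<close>.\<close>
    define T where "T x = (if p \<le> x then r else Gi (S x))" for x
    have Gi_S: "0 \<le> Gi (S x) \<and> Gi (S x) \<le> r \<and> ?G (Gi (S x)) = S x" if "x < p" for x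
      using S_antimono[of x p] that Sp_r S01 by (intro Gi) auto
    have T_bounds: "0 \<le> T x" "T x \<le> r" for x using Gi_S[of x] r by (auto simp: T_def)
    have T_ge: "T x = r" if "p \<le> x" for x using that by (simp add: T_def)
    have T_le_iff: "v \<le> T x \<longleftrightarrow> S x \<le> ?G v" if v: "0 \<le> v" "v \<le> r" for v x
    proof (cases "p \<le> x")
      case True
      have "S x \<le> ?G r" using S_antimono[OF True] Sp_r G_r by simp
      also have "\<dots> \<le> ?G v" using v by (rule G_antimono)
      finally show ?thesis using True v by (simp add: T_def)
    next
      case False
      then have "x < p" by simp
      then show ?thesis
        using Gi_S[of x] G_less_iff[OF v(1), of "Gi (S x)"] G_less_iff[of "Gi (S x)" v] v(1)
        by (simp add: T_def) (metis not_le)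
    qed
    have "mono T"
    proof (rule monoI)
      fix x y :: real assume "x \<le> y"
      then show "T x \<le> T y"
        using T_le_iff[OF T_bounds, of x x] T_le_iff[OF T_bounds, of x y] S_antimono[of x y] by auto
    qed
    then have T_meas: "T \<in> borel_measurable borel" by (rule borel_measurable_mono)
    have tail: "measure F {x. v \<le> T x} = ?G v" if v: "0 \<le> v" "v \<le> r" for v
    proof -
      have "S p \<le> ?G v" using G_antimono[OF v] Sp_r G_r by simp
      then show ?thesis
        using measure_tail_le[OF neg \<open>0 < p\<close> atom _ G_le_1[OF v(1)]]
        by (simp add: T_le_iff[OF v] S_def)
    qed
    have "AE x in F. T x \<le> r / p * x"
      using AE_nonneg[OF neg]
    proof eventually_elim
      case (elim x)
      show ?case
      proof (cases "p \<le> x")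
        case True
        then show ?thesis using r \<open>0 < p\<close> by (simp add: T_def field_simps)
      next
        case False
        then have x: "x < p" by simp
        \<comment> \<open>The right side equals \<open>S x\<close>, which dominates the rescaled
          Pareto tail; as the tail decreases strictly, \<open>T x\<close> cannot exceed
          \<open>x * (r / p)\<close>.\<close>
        have "?G (x * (r / p)) \<le> ?G (T x)" using G_le[OF elim] x Gi_S[OF x] by (simp add: T_def)
        then have "\<not> x * (r / p) < T x"
          using G_less_iff[of "x * (r / p)" "T x"] elim r \<open>0 < p\<close> T_bounds(1)[of x] by auto
        then show ?thesis by (simp add: mult.commute)
      qed
    qed
    then show ?thesis
      using distr_gpd[OF l range T_meas T_bounds(2) tail] T_meas T_bounds T_ge r
      by (intro that[of r T]) auto
  qed
qed

section \<open>Comparison of revenues\<close>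

lemma distr_PiM_map:
  fixes F :: "real measure"
  assumes "value_measure F" "T \<in> borel_measurable borel" "finite I"
  shows "distr (PiM I (\<lambda>_. F)) (PiM I (\<lambda>_. distr F borel T)) (compose I T) =
    PiM I (\<lambda>_. distr F borel T)"
proof -
  interpret value_measure F by fact
  let ?H = "distr F borel T"
  have T: "T \<in> measurable F borel" using assms(2) measurable_cong_sets[OF sets_F refl] by blast
  have "distr (PiM I (\<lambda>_. F)) (PiM I (\<lambda>_. ?H)) (compose I T) = PiM I (\<lambda>_. distr F ?H T)"
    by (rule distr_PiM_finite_prob_space')
      (auto intro: prob_space_axioms prob_space_distr T assms(3))
  also have "distr F ?H T = ?H" by (rule distr_cong) auto
  finally show ?thesis .
qed

lemma compose_measurable:
  fixes F :: "real measure"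
  assumes "value_measure F" "T \<in> borel_measurable borel"
  shows "compose I T \<in> measurable (PiM I (\<lambda>_. F)) (PiM I (\<lambda>_. distr F borel T))"
proof -
  interpret value_measure F by fact
  have "(\<lambda>x. T (x i)) \<in> measurable (PiM I (\<lambda>_. F)) (distr F borel T)" if "i \<in> I" for i
    using measurable_compose[OF component_measurable[OF sets_F that] assms(2)] by simp
  then show ?thesis unfolding compose_def by (rule measurable_restrict)
qed

lemma OPT_payment_measurable:
  fixes F :: "real measure"
  assumes "sets F = sets borel" "0 \<le> p"
  shows "OPT_payment m n p \<in> borel_measurable (\<Pi>\<^sub>M i\<in>{..<n}. F)"
proof -
  have "OPT_payment m n p = (\<lambda>x. p * min (real m) (real (card {i. i < n \<and> p \<le> x i}))
      + m * max (losing_value m n x - p) 0)"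
    by (rule ext) (simp add: OPT_payment_eq[OF assms(2)] of_nat_min)
  then show ?thesis
    by (simp only:) (intro borel_measurable_add borel_measurable_times borel_measurable_const
      borel_measurable_min borel_measurable_max borel_measurable_diff
      card_above_measurable losing_value_measurable assms(1))
qed

lemma OPT_payment_cong:
  assumes "0 \<le> p" "\<And>i. i < n \<Longrightarrow> x i = y i"
  shows "OPT_payment m n p x = OPT_payment m n p y"
proof -
  have "{i. i < n \<and> p \<le> x i} = {i. i < n \<and> p \<le> y i}" using assms(2) by auto
  then show ?thesis
    using losing_value_cong[of n x y m] assms(2) by (simp add: OPT_payment_eq[OF assms(1)])
qed

lemma losing_value_scale_le:
  assumes "0 < c" "m < N" and le: "\<And>i. i < N \<Longrightarrow> c * y i \<le> x i"
  shows "c * losing_value m N y \<le> losing_value m N x"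
proof -
  define v where "v = losing_value m N y"
  have "{i. i < N \<and> v \<le> y i} \<subseteq> {i. i < N \<and> c * v \<le> x i}"
    using le assms(1) by (auto intro: order_trans[OF mult_left_mono])
  then have "card {i. i < N \<and> v \<le> y i} \<le> card {i. i < N \<and> c * v \<le> x i}"
    by (intro card_mono) auto
  moreover have "m < card {i. i < N \<and> v \<le> y i}"
    using losing_value_ge_iff[OF assms(2), of v y] by (simp add: v_def)
  ultimately show ?thesis using losing_value_ge_iff[OF assms(2), of "c * v" x] by (simp add: v_def)
qed

lemma losing_value_le:
  assumes "0 \<le> b" and le: "\<And>i. i < N \<Longrightarrow> y i \<le> b"
  shows "losing_value m N y \<le> b"
proof (cases "m < N")
  case True
  then have "m < card {i. i < N \<and> losing_value m N y \<le> y i}"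
    using losing_value_ge_iff[OF True, of "losing_value m N y" y] by simp
  then have "{i. i < N \<and> losing_value m N y \<le> y i} \<noteq> {}" by (metis card.empty not_less0)
  then show ?thesis using le by (auto intro: order_trans)
qed (simp add: losing_value_def assms)

text \<open>Below \<open>p\<close> the losing value of the larger market is bounded through the coupled profile
  \<open>y\<close>; above \<open>p\<close> it is bounded through the smaller market.\<close>

lemma losing_value_coupled_ge:
  assumes m: "1 \<le> m" "m \<le> n" "n \<le> N" and pr: "0 < p" "0 < r"
    and x: "\<And>i. i < N \<Longrightarrow> 0 \<le> x i" and y: "\<And>i. i < N \<Longrightarrow> y i \<le> r / p * x i" "\<And>i. i < N \<Longrightarrow> y i \<le> r"
  shows "p / r * losing_value m N y + max (losing_value m n x - p) 0 \<le> losing_value m N x"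
proof -
  let ?a = "losing_value m N x" and ?b = "losing_value m N y" and ?c = "losing_value m n x"
  have "?c \<le> ?a" using m(3) x by (intro losing_value_mono_agents) auto
  have "?b \<le> r" using y pr by (intro losing_value_le) auto
  then have "p / r * ?b \<le> p / r * r" using pr by (intro mult_left_mono) auto
  then have 1: "p / r * ?b \<le> p" using pr by simp
  have 2: "p / r * ?b \<le> ?a"
  proof (cases "m < N")
    case True
    have "p / r * y i \<le> x i" if "i < N" for i
      using mult_left_mono[OF y(1)[OF that], of "p / r"] pr by simp
    then show ?thesis using pr True by (intro losing_value_scale_le) auto
  qed (simp add: losing_value_def)
  show ?thesis
  proof (cases "?c \<le> p")
    case True
    then show ?thesis using 2 by simp
  next
    case False
    then show ?thesis using 1 \<open>?c \<le> ?a\<close> by simp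
  qed
qed

text \<open>Optimality of the reserve acts as a Markov inequality whose constant is the reserve
  revenue. It gives integrability, and forces all mass to 0 when that revenue is 0.\<close>

lemma reserve_tail_bound:
  assumes "value_measure F" "monopoly_reserve F p" "0 < v"
  shows "measure F {v..} \<le> p * (1 - CDF F p) / v"
proof -
  interpret value_measure F by fact
  have "v * (1 - CDF F v) \<le> p * (1 - CDF F p)"
    using assms(2,3) by (simp add: monopoly_reserve_def)
  then show ?thesis using assms(3) by (simp add: measure_atLeast field_simps)
qed

lemma RevVCG_eq: "m \<le> N \<Longrightarrow> RevVCG m N F = m * (\<integral>x. losing_value m N x \<partial>(\<Pi>\<^sub>M i\<in>{..<N}. F))"
  by (simp add: RevVCG_def VCG_payment_eq)

text \<open>The payment reads only the first \<open>n\<close> coordinates, so both auctions can be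
  run on the same \<open>N\<close> values.\<close>

lemma RevOPT_larger_market:
  assumes "value_measure F" "0 \<le> p" "n \<le> N"
  shows "RevOPT m n F p = (\<integral>x. OPT_payment m n p x \<partial>(\<Pi>\<^sub>M i\<in>{..<N}. F))"
proof -
  interpret value_measure F by fact
  interpret P: product_prob_space "\<lambda>_::nat. F" "{..<N}" ..
  let ?P = "\<Pi>\<^sub>M i\<in>{..<N}. F"
  have "(\<Pi>\<^sub>M i\<in>{..<n}. F) = distr ?P (\<Pi>\<^sub>M i\<in>{..<n}. F) (\<lambda>x. restrict x {..<n})"
    using assms(3) by (intro P.distr_restrict) auto
  then have "RevOPT m n F p =
      (\<integral>x. OPT_payment m n p x \<partial>distr ?P (\<Pi>\<^sub>M i\<in>{..<n}. F) (\<lambda>x. restrict x {..<n}))"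
    by (simp add: RevOPT_def)
  also have "\<dots> = (\<integral>x. OPT_payment m n p (restrict x {..<n}) \<partial>?P)"
    using assms(3)
    by (intro integral_distr measurable_restrict_subset OPT_payment_measurable assms(2) sets_F) auto
  also have "\<dots> = (\<integral>x. OPT_payment m n p x \<partial>?P)"
    by (intro Bochner_Integration.integral_cong OPT_payment_cong assms(2)) auto
  finally show ?thesis .
qed

text \<open>On each profile the optimal payment is \<open>q + m * e\<close> with \<open>q\<close> at
  most \<open>p / r\<close> times the Pareto payment \<open>h\<close>, whereas almost surely the
  losing value \<open>a\<close> is at least \<open>p / r * b + e\<close> with \<open>b\<close> that
  of the image profile. Expectations of these bounds combine with the hypothesis on the image
  law.\<close>

lemma revenue_comparison:
  fixes F :: "real measure"
  defines "H \<equiv> \<lambda>T. distr F borel T"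
  assumes F: "value_measure F" and neg: "measure F {..<0} = 0" and reserve: "monopoly_reserve F p"
    and m: "1 \<le> m" "m \<le> n" and \<Gamma>: "0 < \<Gamma>" "\<Gamma> \<le> 1" and pr: "0 < p" "0 < r"
    and T: "T \<in> borel_measurable borel" "AE x in F. T x \<le> r / p * x"
      "\<And>x. 0 \<le> T x" "\<And>x. T x \<le> r" "\<And>x. p \<le> x \<Longrightarrow> T x = r"
    and ge: "\<Gamma> * RevOPT m n (H T) r \<le> RevVCG m (n + k) (H T)"
  shows "\<Gamma> * RevOPT m n F p \<le> RevVCG m (n + k) F"
proof -
  interpret value_measure F by fact
  define N where "N = n + k"
  have N: "n \<le> N" "m \<le> N" using m by (auto simp: N_def)
  let ?P = "\<Pi>\<^sub>M i\<in>{..<N}. F" and ?H = "H T"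
  interpret P: product_prob_space "\<lambda>_::nat. F" "{..<N}" ..
  have T': "T \<in> measurable F borel" using T(1) measurable_cong_sets[OF sets_F refl] by blast
  have H: "value_measure ?H"
    unfolding H_def using prob_space_distr[OF T'] by (simp add: value_measure_def value_measure_axioms_def)
  have setsH: "sets ?H = sets borel" by (simp add: H_def)
  have comp: "compose {..<N} T \<in> measurable ?P (\<Pi>\<^sub>M i\<in>{..<N}. ?H)"
    unfolding H_def by (rule compose_measurable[OF F T(1)])
  have distr: "(\<Pi>\<^sub>M i\<in>{..<N}. ?H) = distr ?P (\<Pi>\<^sub>M i\<in>{..<N}. ?H) (compose {..<N} T)"
    unfolding H_def by (rule distr_PiM_map[OF F T(1), symmetric]) simp
  have comp_eq: "compose {..<N} T x i = T (x i)" if "i < N" for x i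
    using that by (simp add: compose_def)
  define a where "a x = losing_value m N x" for x
  define b where "b x = losing_value m N (compose {..<N} T x)" for x
  define e where "e x = max (losing_value m n x - p) 0" for x
  define q where "q x = p * min m (card {i. i < n \<and> p \<le> x i})" for x :: "nat \<Rightarrow> real"
  define h where "h x = OPT_payment m n r (compose {..<N} T x)" for x
  have restr: "losing_value m n (restrict x {..<n}) = losing_value m n x"
    "card {i. i < n \<and> v \<le> restrict x {..<n} i} = card {i. i < n \<and> v \<le> x i}" for x v
    by (auto intro!: losing_value_cong arg_cong[where f = card])
  have restr_meas: "(\<lambda>x. restrict x {..<n}) \<in> measurable ?P (\<Pi>\<^sub>M i\<in>{..<n}. F)"
    using N by (intro measurable_restrict_subset) auto
  have c_meas: "losing_value m n \<in> borel_measurable ?P"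
    using measurable_compose[OF restr_meas losing_value_measurable[OF sets_F, of m]]
    by (simp only: restr)
  have e_meas: "e \<in> borel_measurable ?P" unfolding e_def
    by (intro borel_measurable_max borel_measurable_diff borel_measurable_const c_meas)
  have "(\<lambda>x. real (card {i. i < n \<and> v \<le> x i})) \<in> borel_measurable ?P" for v
    using measurable_compose[OF restr_meas card_above_measurable[OF sets_F, of _ v]] by (simp only: restr)
  then have q_meas: "q \<in> borel_measurable ?P" unfolding q_def of_nat_min
    by (intro borel_measurable_times borel_measurable_min borel_measurable_const)
  have b_meas: "b \<in> borel_measurable ?P"
    unfolding b_def by (rule measurable_compose[OF comp losing_value_measurable[OF setsH]])
  have h_meas: "h \<in> borel_measurable ?P"
  proof -
    have "OPT_payment m n r (restrict (compose {..<N} T x) {..<n}) = OPT_payment m n r (compose {..<N} T x)" for x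
      using pr by (intro OPT_payment_cong) auto
    moreover have "(\<lambda>x. OPT_payment m n r (restrict (compose {..<N} T x) {..<n})) \<in> borel_measurable ?P"
      using N pr by (intro measurable_compose[OF comp]
        measurable_compose[OF measurable_restrict_subset OPT_payment_measurable] setsH) auto
    ultimately show ?thesis unfolding h_def by simp
  qed
  have AE_x: "AE x in ?P. \<forall>i\<in>{..<N}. 0 \<le> x i \<and> T (x i) \<le> r / p * x i"
    using AE_nonneg[OF neg] T(2)
    by (intro AE_ball_countable[THEN iffD2] ballI AE_PiM_component prob_space_axioms) auto
  have a_int: "integrable ?P a"
    unfolding a_def using neg reserve_tail_bound[OF F reserve] m(1)
    by (intro integrable_losing_value[where C = "p * (1 - CDF F p)"] prob_space_axioms sets_F) auto
  have ineq: "AE x in ?P. p / r * b x + e x \<le> a x"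
    using AE_x
  proof eventually_elim
    case (elim x)
    then show ?case unfolding a_def b_def e_def
      using m N pr T(4) by (intro losing_value_coupled_ge) (auto simp: comp_eq)
  qed
  have b_nonneg: "0 \<le> b x" for x
    unfolding b_def by (rule losing_value_nonneg) (simp add: comp_eq T(3))
  have b_le: "b x \<le> r" for x
    unfolding b_def by (rule losing_value_le) (use pr in \<open>auto simp: comp_eq T(4)\<close>)
  have e_nonneg: "0 \<le> e x" for x by (simp add: e_def)
  have b_int: "integrable ?P b"
    by (rule P.integrable_const_bound[where B = r]) (use b_nonneg b_le b_meas in auto)
  have e_int: "integrable ?P e"
  proof (rule Bochner_Integration.integrable_bound[OF a_int e_meas])
    show "AE x in ?P. norm (e x) \<le> norm (a x)"
      using ineq
    proof eventually_elim
      case (elim x)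
      have "0 \<le> p / r * b x" using b_nonneg[of x] pr by simp
      with elim e_nonneg[of x] show ?case by simp
    qed
  qed
  have q_bounds: "0 \<le> q x" "q x \<le> p * m" for x
    using pr by (auto simp: q_def intro!: mult_left_mono)
  have q_int: "integrable ?P q"
    by (rule P.integrable_const_bound[where B = "p * m"]) (use q_bounds q_meas in auto)
  \<comment> \<open>Image values never exceed \<open>r\<close>, so no excess over the reserve
    remains in the Pareto market.\<close>
  have h_eq: "h x = r * min m (card {i. i < n \<and> r \<le> T (x i)})" for x
  proof -
    have "losing_value m n (compose {..<N} T x) \<le> r"
      using N pr by (intro losing_value_le) (auto simp: comp_eq T(4))
    moreover have "{i. i < n \<and> r \<le> compose {..<N} T x i} = {i. i < n \<and> r \<le> T (x i)}"
      using N by (auto simp: comp_eq)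
    ultimately show ?thesis using pr by (simp add: h_def OPT_payment_eq)
  qed
  have h_bounds: "0 \<le> h x" "h x \<le> r * m" for x
    using pr by (auto simp: h_eq intro!: mult_left_mono)
  have h_int: "integrable ?P h"
    by (rule P.integrable_const_bound[where B = "r * m"]) (use h_bounds h_meas in auto)
  \<comment> \<open>Every buyer who reaches \<open>p\<close> is sent to \<open>r\<close>, so no sale
    is lost.\<close>
  have q_le_h: "q x \<le> p / r * h x" for x
  proof -
    have "card {i. i < n \<and> p \<le> x i} \<le> card {i. i < n \<and> r \<le> T (x i)}"
      using T(5) by (intro card_mono) auto
    then have "p * real (min m (card {i. i < n \<and> p \<le> x i})) \<le>
        p * real (min m (card {i. i < n \<and> r \<le> T (x i)}))"
      using pr by (intro mult_left_mono) auto
    then show ?thesis using pr by (simp add: q_def h_eq)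
  qed
  have VCG_H: "RevVCG m N ?H = m * (\<integral>x. b x \<partial>?P)"
    unfolding RevVCG_eq[OF N(2)] b_def
    by (subst distr) (simp add: integral_distr[OF comp] losing_value_measurable setsH)
  have OPT_H: "RevOPT m n ?H r = (\<integral>x. h x \<partial>?P)"
  proof -
    have meas: "OPT_payment m n r \<in> borel_measurable (\<Pi>\<^sub>M i\<in>{..<N}. ?H)"
    proof -
      have "OPT_payment m n r (restrict x {..<n}) = OPT_payment m n r x" for x
        using pr by (intro OPT_payment_cong) auto
      moreover have "(\<lambda>x. OPT_payment m n r (restrict x {..<n})) \<in> borel_measurable (\<Pi>\<^sub>M i\<in>{..<N}. ?H)"
        using N pr by (intro measurable_compose[OF measurable_restrict_subset OPT_payment_measurable] setsH) auto
      ultimately show ?thesis by simp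
    qed
    have "RevOPT m n ?H r = (\<integral>x. OPT_payment m n r x \<partial>(\<Pi>\<^sub>M i\<in>{..<N}. ?H))"
      using pr by (intro RevOPT_larger_market H N) auto
    also have "\<dots> = (\<integral>x. h x \<partial>?P)"
      unfolding h_def by (subst distr) (rule integral_distr[OF comp meas])
    finally show ?thesis .
  qed
  have "RevOPT m n F p = (\<integral>x. q x + m * e x \<partial>?P)"
  proof -
    have "RevOPT m n F p = (\<integral>x. OPT_payment m n p x \<partial>?P)"
      using pr by (intro RevOPT_larger_market F N) auto
    then show ?thesis using pr by (simp add: OPT_payment_eq q_def e_def)
  qed
  also have "\<dots> = (\<integral>x. q x \<partial>?P) + m * (\<integral>x. e x \<partial>?P)"
    using q_int e_int by simp
  also have "(\<integral>x. q x \<partial>?P) \<le> (\<integral>x. p / r * h x \<partial>?P)"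
    using q_int h_int q_le_h by (intro integral_mono) auto
  also have "(\<integral>x. p / r * h x \<partial>?P) = p / r * RevOPT m n ?H r"
    by (simp add: OPT_H)
  finally have OPT_F: "RevOPT m n F p \<le> p / r * RevOPT m n ?H r + m * (\<integral>x. e x \<partial>?P)" by simp
  have e_int_nonneg: "0 \<le> (\<integral>x. e x \<partial>?P)" using e_nonneg by simp
  have "\<Gamma> * RevOPT m n F p \<le> \<Gamma> * (p / r * RevOPT m n ?H r + m * (\<integral>x. e x \<partial>?P))"
    using OPT_F \<Gamma> by (intro mult_left_mono) auto
  also have "\<dots> = p / r * (\<Gamma> * RevOPT m n ?H r) + \<Gamma> * (m * (\<integral>x. e x \<partial>?P))"
    by (simp add: algebra_simps)
  \<comment> \<open>The hypothesis on the image law bounds the first summand;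
    \<open>\<Gamma> \<le> 1\<close> and \<open>e \<ge> 0\<close> bound the second.\<close>
  also have "\<dots> \<le> p / r * RevVCG m N ?H + 1 * (m * (\<integral>x. e x \<partial>?P))"
    using ge pr \<Gamma> e_int_nonneg by (intro add_mono mult_left_mono mult_right_mono) (auto simp: N_def)
  also have "\<dots> = m * (\<integral>x. p / r * b x + e x \<partial>?P)"
    using b_int e_int by (simp add: VCG_H algebra_simps)
  also have "\<dots> \<le> m * (\<integral>x. a x \<partial>?P)"
    using ineq b_int e_int a_int by (intro mult_left_mono integral_mono_AE) auto
  also have "\<dots> = RevVCG m N F" by (simp add: RevVCG_eq[OF N(2)] a_def)
  finally show ?thesis by (simp add: N_def)
qed

text \<open>Zero reserve revenue leaves no mass above 0, so the optimal payment vanishes almost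
  surely. Neither the parameter \<open>1 / (1 - CDF F p)\<close> nor the factor \<open>r / p\<close>
  would make sense in all these cases.\<close>

lemma revenue_comparison_degenerate:
  assumes F: "value_measure F" and neg: "measure F {..<0} = 0" and reserve: "monopoly_reserve F p"
    and p: "0 \<le> p" "p = 0 \<or> CDF F p = 1" and m: "m \<le> n"
  shows "\<Gamma> * RevOPT m n F p \<le> RevVCG m (n + k) F"
proof -
  interpret value_measure F by fact
  have tail: "measure F {v..} = 0" if "0 < v" for v
    using reserve_tail_bound[OF F reserve that] p by (auto simp: measure_le_0_iff)
  have nonpos: "AE x in F. x \<le> 0"
    by (rule AE_I[of _ _ "{0<..}"]) (auto simp: emeasure_eq_measure measure_greaterThan_eq_0 tail)
  have "AE x in (\<Pi>\<^sub>M i\<in>{..<n}. F). \<forall>i\<in>{..<n}. x i \<le> 0"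
    using nonpos by (intro AE_ball_countable[THEN iffD2] ballI AE_PiM_component prob_space_axioms) auto
  then have "AE x in (\<Pi>\<^sub>M i\<in>{..<n}. F). OPT_payment m n p x = 0"
  proof eventually_elim
    case (elim x)
    then have "losing_value m n x \<le> 0" by (intro losing_value_le) auto
    then have los: "max (losing_value m n x - p) 0 = 0" using p(1) by simp
    show ?case
    proof (cases "p = 0")
      case True
      then show ?thesis using los by (simp add: OPT_payment_eq)
    next
      case False
      have "\<not> p \<le> x i" if "i < n" for i using elim that p(1) False by force
      then have "{i. i < n \<and> p \<le> x i} = {}" by simp
      then show ?thesis unfolding OPT_payment_eq[OF p(1)] los by (simp only:) simp
    qed
  qed
  then have "RevOPT m n F p = 0" unfolding RevOPT_def by (rule integral_eq_zero_AE)
  moreover have "AE x in (\<Pi>\<^sub>M i\<in>{..<n + k}. F). \<forall>i\<in>{..<n + k}. 0 \<le> x i"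
    using AE_nonneg[OF neg]
    by (intro AE_ball_countable[THEN iffD2] ballI AE_PiM_component prob_space_axioms) auto
  then have "AE x in (\<Pi>\<^sub>M i\<in>{..<n + k}. F). 0 \<le> VCG_payment m (n + k) x"
  proof eventually_elim
    case (elim x)
    then show ?case using m by (auto simp: VCG_payment_eq intro!: losing_value_nonneg mult_nonneg_nonneg)
  qed
  then have "0 \<le> RevVCG m (n + k) F" unfolding RevVCG_def by (rule integral_nonneg_AE)
  ultimately show ?thesis by simp
qed

theorem proposition4p1:
  fixes l \<Gamma> :: real and m n :: nat
  assumes "0 \<le> l" and "l \<le> 1"
    and "1 \<le> m" and "m \<le> n"
    and "0 < \<Gamma>" and "\<Gamma> \<le> 1"
  shows "gpd_class l \<subset> regular_class l \<and>
    CC m n (regular_class l) \<Gamma> = CC m n (gpd_class l) \<Gamma>"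
proof
  show sub: "gpd_class l \<subset> regular_class l" using assms(1,2) by (rule gpd_class_psubset)
  \<comment> \<open>A number \<open>k\<close> that works for the Pareto class works for every
    regular distribution; the converse is the inclusion of the classes.\<close>
  have "\<Gamma> * RevOPT m n F p \<le> RevVCG m (n + k) F"
    if gpd: "\<forall>H\<in>gpd_class l. \<forall>p. monopoly_reserve H p \<longrightarrow> \<Gamma> * RevOPT m n H p \<le> RevVCG m (n + k) H"
      and F: "F \<in> regular_class l" and reserve: "monopoly_reserve F p" for k F p
  proof -
    have val: "valuation_distribution F" using F by (simp add: regular_class_def)
    interpret value_measure F using valuation_value_measure[OF val] .
    have neg: "measure F {..<0} = 0" using val by (simp add: valuation_distribution_def)
    \<comment> \<open>The reserve is only required to lie in the support; its sign follows because
      there is no mass below 0.\<close>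
    have "0 \<le> p"
    proof (rule ccontr)
      assume "\<not> 0 \<le> p"
      moreover have "p \<in> msupp F" using reserve by (simp add: monopoly_reserve_def)
      ultimately have "0 < measure F {p - (- p)<..<p + (- p)}"
        unfolding msupp_def mem_Collect_eq by (metis neg_0_less_iff_less not_le)
      moreover have "measure F {p - (- p)<..<p + (- p)} = 0"
        by (rule measure_eq_0_mono[OF neg]) auto
      ultimately show False by simp
    qed
    show ?thesis
    proof (cases "p = 0 \<or> CDF F p = 1")
      case True
      show ?thesis
        using revenue_comparison_degenerate[OF value_measure_axioms neg reserve \<open>0 \<le> p\<close> True assms(4)] .
    next
      case False
      then have "0 < p" "CDF F p < 1" using \<open>0 \<le> p\<close> by (auto simp: CDF_def less_le)
      then obtain T r where T: "0 < r" "T \<in> borel_measurable borel"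
        "distr F borel T \<in> gpd_class l" "monopoly_reserve (distr F borel T) r"
        "AE x in F. T x \<le> r / p * x" "\<And>x. 0 \<le> T x" "\<And>x. T x \<le> r" "\<And>x. p \<le> x \<Longrightarrow> T x = r"
        by (rule regular_coupling[OF assms(1,2) F reserve]) (rule that, assumption+)
      then show ?thesis
        using gpd by (intro revenue_comparison[OF value_measure_axioms neg reserve assms(3-6) \<open>0 < p\<close> T(1,2,5-8)])
          auto
    qed
  qed
  then have "{k. \<forall>F\<in>regular_class l. \<forall>p. monopoly_reserve F p \<longrightarrow> RevVCG m (n + k) F \<ge> \<Gamma> * RevOPT m n F p} =
      {k. \<forall>F\<in>gpd_class l. \<forall>p. monopoly_reserve F p \<longrightarrow> RevVCG m (n + k) F \<ge> \<Gamma> * RevOPT m n F p}"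
    using sub by blast
  then show "CC m n (regular_class l) \<Gamma> = CC m n (gpd_class l) \<Gamma>" by (simp add: CC_def)
qed

end
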